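(* Let $R$ be a commutative ring with unit, let $\mathcal{A}$ be a set (alphabet), and let $\mu:\mathcal{A}\times\mathcal{A}\to R$ be a mapping. Let $\mathcal{Q}$ be the graded algebra of phrases in the alphabet $\mathcal{A}$ (empty words allowed), and let $\Delta=\Delta_\mu:\mathcal{Q}\to\mathcal{Q}\otimes\mathcal{Q}$ be the unique algebra homomorphism such that for every word $w$ (including the empty word), $$\Delta(w)=w\otimes 1+\sum_{\alpha}\mu(w,\alpha)\,l_\alpha(w)\otimes r_\alpha(w),$$ where $\alpha$ runs over all inscriptions in $w$ (including the empty inscription). Then the pair $(\mathcal{Q},\Delta)$ is a left-handed graded bialgebra with leading term $\rho_\mu$.
   Context: All tensor products are over $R$. Words. A word of length $m\ge 0$ is a finite sequence $w=w(1)\cdots w(m)$ of elements of $\mathcal{A}$; the word of length $0$ is the empty word $\phi$; concatenation is denoted $wx$. For a word $w$ of length $m\ge1$ and $1\le i\le j\le m+1$, $w_{i,j}=w(i)w(i+1)\cdots w(j-1)$ (empty iff $i=j$). $\mathcal{W}$ is the free $R$-module with basis the set of all words, including $\phi$. Phrases. A phrase of length $k\ge0$ is a finite sequence $(w_1|w_2|\cdots|w_k)$ of $k$ words, some or all of which may be empty; the empty phrase ($k=0$) is denoted $1$ (it is different from the one-word phrase $(\phi)$). $\mathcal{Q}$ is the free $R$-module with basis the set of all phrases, with multiplication given by concatenation of phrases, $(w_1|\cdots|w_k)(x_1|\cdots|x_t)=(w_1|\cdots|w_k|x_1|\cdots|x_t)$; it is an associative algebra with unit $1$, graded by the length of phrases.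 A word $w$ is identified with the one-word phrase $(w)$, so the degree $1$ part of $\mathcal{Q}$ is $\mathcal{W}$, and $\mathcal{Q}=T(\mathcal{W})$ is the tensor algebra of $\mathcal{W}$. Inscriptions. Let $w$ be a word of length $m\ge0$. An inscription in $w$ of length $k\ge0$ is a subset $\alpha\subset\{1,\ldots,m\}$ with $2k$ elements, written in increasing order as $\alpha=(i_1,j_1,\ldots,i_k,j_k)$ with $i_1<j_1<i_2<j_2<\cdots<i_k<j_k$. Set $$l_\alpha(w)=(w_{i_1+1,j_1}|w_{i_2+1,j_2}|\cdots|w_{i_k+1,j_k})\in\mathcal{Q},\qquad \mu(w,\alpha)=\prod_{u=1}^k\mu(w(i_u),w(j_u))\in R,$$ and let $r_\alpha(w)$ be the word $w_{1,i_1}w_{j_1+1,i_2}\cdots w_{j_{k-1}+1,i_k}w_{j_k+1,m+1}$. For $\alpha=\emptyset$: $l_\alpha(w)=1$, $\mu(w,\alpha)=1$, $r_\alpha(w)=w$. Map $\rho_\mu$. $\rho_\mu:\mathcal{W}\to\mathcal{W}\otimes\mathcal{W}$ is the $R$-linear map with $\rho_\mu(w)=\sum_{1\le i<j\le m}\mu(w(i),w(j))\,w_{i+1,j}\otimes w_{1,i}w_{j+1,m+1}$ for each word $w$ of length $m\ge 0$. Bialgebras. A bialgebra here is a pair $(T,\Delta)$ where $T$ is an associative unital $R$-algebra and $\Delta:T\to T\otimes T$ is an $R$-linear coassociative map with $\Delta(1)=1\otimes1$ and $\Delta(ab)=\Delta(a)\Delta(b)$, where $(a\otimes a')(b\otimes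 b')=ab\otimes a'b'$ in $T\otimes T$; a counit is not required. It is graded if $T=\bigoplus_{m\ge0}T^m$ with $1\in T^0$ and $T^mT^n\subset T^{m+n}$ (no compatibility of $\Delta$ with the grading is required); set $T_+=\bigoplus_{m\ge1}T^m$. A graded bialgebra is left-handed if $\Delta(a)-a\otimes1-1\otimes a\in T_+\otimes T^1$ for all $a\in T^1$. The leading term of $\Delta$ is then $(\pi\otimes\pi)\Delta|_{T^1}:T^1\to T^1\otimes T^1$, where $\pi:T\to T^1$ is the projection. *)

theory Defs
  imports Complex_Main "HOL-Library.Poly_Mapping" "HOL-Library.Product_Plus" "HOL-Library.FuncSet"
begin

section \<open>Free modules\<close>

text \<open>
  The free \<open>R\<close>-module with basis \<open>B\<close> consists of the finitely supported functions \<open>B \<rightarrow> R\<close>.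
  The basis is a subset of a type (rather than a type), so that it may depend on an arbitrary,
  possibly empty, alphabet.
\<close>

definition free_on :: "'b set \<Rightarrow> ('b \<Rightarrow>\<^sub>0 'r::zero) set" where
  "free_on B = {p. Poly_Mapping.keys p \<subseteq> B}"

definition smul :: "'r::comm_ring_1 \<Rightarrow> ('b \<Rightarrow>\<^sub>0 'r) \<Rightarrow> ('b \<Rightarrow>\<^sub>0 'r)" where
  "smul c p = Poly_Mapping.map ((*) c) p"

lemma lookup_smul [simp]: "Poly_Mapping.lookup (smul c p) b = c * Poly_Mapping.lookup p b"
  by (simp add: smul_def Poly_Mapping.map.rep_eq when_def)

global_interpretation free_mod: module "smul :: 'r::comm_ring_1 \<Rightarrow> ('b \<Rightarrow>\<^sub>0 'r) \<Rightarrow> _"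
  by standard (auto intro!: poly_mapping_eqI simp: lookup_add algebra_simps)

abbreviation basis :: "'b \<Rightarrow> ('b \<Rightarrow>\<^sub>0 'r::comm_ring_1)" where
  "basis b \<equiv> Poly_Mapping.single b 1"

text \<open>The linear map with prescribed values on the basis.\<close>

definition lin_ext :: "('b \<Rightarrow> 'c \<Rightarrow>\<^sub>0 'r) \<Rightarrow> ('b \<Rightarrow>\<^sub>0 'r) \<Rightarrow> ('c \<Rightarrow>\<^sub>0 'r::comm_ring_1)" where
  "lin_ext f p = (\<Sum>b\<in>Poly_Mapping.keys p. smul (Poly_Mapping.lookup p b) (f b))"

definition linear_on ::
  "('b \<Rightarrow>\<^sub>0 'r::comm_ring_1) set \<Rightarrow> (('b \<Rightarrow>\<^sub>0 'r) \<Rightarrow> ('c \<Rightarrow>\<^sub>0 'r)) \<Rightarrow> bool" where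
  "linear_on U f \<longleftrightarrow>
     (\<forall>x\<in>U. \<forall>y\<in>U. f (x + y) = f x + f y) \<and> (\<forall>c. \<forall>x\<in>U. f (smul c x) = smul c (f x))"


section \<open>Tensor products of free modules\<close>

text \<open>
  The tensor product of the free modules with bases \<open>B\<close> and \<open>C\<close> is the free module with basis
  \<open>B \<times> C\<close>, where \<open>b \<otimes> c\<close> is the basis element \<open>(b, c)\<close>. Its universal property is
  \<open>tensor_product_universal\<close> below.
\<close>

definition tens :: "('b \<Rightarrow>\<^sub>0 'r) \<Rightarrow> ('c \<Rightarrow>\<^sub>0 'r) \<Rightarrow> ('b \<times> 'c \<Rightarrow>\<^sub>0 'r::comm_ring_1)"
    (infixr \<open>\<otimes>\<^sub>R\<close> 72) where
  "p \<otimes>\<^sub>R q = lin_ext (\<lambda>b. lin_ext (\<lambda>c. basis (b, c)) q) p"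

definition tensor_map ::
  "(('b \<Rightarrow>\<^sub>0 'r) \<Rightarrow> ('d \<Rightarrow>\<^sub>0 'r)) \<Rightarrow> (('c \<Rightarrow>\<^sub>0 'r) \<Rightarrow> ('e \<Rightarrow>\<^sub>0 'r)) \<Rightarrow>
   ('b \<times> 'c \<Rightarrow>\<^sub>0 'r) \<Rightarrow> ('d \<times> 'e \<Rightarrow>\<^sub>0 'r::comm_ring_1)" where
  "tensor_map f g = lin_ext (\<lambda>(b, c). f (basis b) \<otimes>\<^sub>R g (basis c))"

definition tensor_assoc :: "(('b \<times> 'c) \<times> 'd \<Rightarrow>\<^sub>0 'r) \<Rightarrow> ('b \<times> 'c \<times> 'd \<Rightarrow>\<^sub>0 'r::comm_ring_1)" where
  "tensor_assoc = lin_ext (\<lambda>((b, c), d). basis (b, c, d))"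

text \<open>
  The image of \<open>U \<otimes> V\<close> in the tensor product of the ambient modules; for direct summands
  \<open>U\<close> and \<open>V\<close>, such as graded components, this is \<open>U \<otimes> V\<close> itself.
\<close>

definition tensor_sub ::
  "('b \<Rightarrow>\<^sub>0 'r) set \<Rightarrow> ('c \<Rightarrow>\<^sub>0 'r) set \<Rightarrow> ('b \<times> 'c \<Rightarrow>\<^sub>0 'r::comm_ring_1) set" where
  "tensor_sub U V = free_mod.span {u \<otimes>\<^sub>R v | u v. u \<in> U \<and> v \<in> V}"

lemma smul_basis: "smul a (Poly_Mapping.single b c) = Poly_Mapping.single b (a * c)"
  by (rule poly_mapping_eqI) (simp add: lookup_single when_def)

lemma lookup_tens [simp]:
  "Poly_Mapping.lookup (p \<otimes>\<^sub>R q) (b, c) = Poly_Mapping.lookup p b * Poly_Mapping.lookup q c"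
proof -
  have inner: "Poly_Mapping.lookup (lin_ext (\<lambda>c'. basis (b', c')) q) (b, c)
      = (if b' = b then Poly_Mapping.lookup q c else 0)" for b'
    by (simp add: lin_ext_def lookup_sum lookup_single when_def sum.delta in_keys_iff
        if_distrib [of "\<lambda>x. _ * x"] cong: if_cong)
  show ?thesis
    unfolding tens_def
    by (subst lin_ext_def)
      (simp add: lookup_sum inner in_keys_iff if_distrib [of "\<lambda>x. _ * x"] cong: if_cong)
qed

lemma tens_add_left: "(p + p') \<otimes>\<^sub>R q = p \<otimes>\<^sub>R q + p' \<otimes>\<^sub>R q"
  and tens_add_right: "p \<otimes>\<^sub>R (q + q') = p \<otimes>\<^sub>R q + p \<otimes>\<^sub>R q'"
  and tens_smul_left: "smul c p \<otimes>\<^sub>R q = smul c (p \<otimes>\<^sub>R q)"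
  and tens_smul_right: "p \<otimes>\<^sub>R smul c q = smul c (p \<otimes>\<^sub>R q)"
  and tens_basis: "basis b \<otimes>\<^sub>R basis d = (basis (b, d) :: _ \<Rightarrow>\<^sub>0 'r::comm_ring_1)"
  by (auto intro!: poly_mapping_eqI simp: lookup_add lookup_single when_def algebra_simps)

lemma keys_tens_subset:
  "Poly_Mapping.keys (p \<otimes>\<^sub>R q) \<subseteq> Poly_Mapping.keys p \<times> Poly_Mapping.keys q"
  by (auto simp: in_keys_iff)

lemma zero_in_free_on [simp]: "0 \<in> free_on B"
  and basis_in_free_on: "b \<in> B \<Longrightarrow> Poly_Mapping.single b c \<in> free_on B"
  and add_in_free_on: "p \<in> free_on B \<Longrightarrow> q \<in> free_on B \<Longrightarrow> p + q \<in> free_on B"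
  and smul_in_free_on: "p \<in> free_on B \<Longrightarrow> smul a p \<in> free_on B"
  by (auto simp: free_on_def in_keys_iff lookup_add lookup_single when_def)
    (metis add.right_neutral subset_iff in_keys_iff, metis mult_zero_right subset_iff in_keys_iff)

lemma sum_in_free_on:
  fixes f :: "'i \<Rightarrow> 'b \<Rightarrow>\<^sub>0 'r::comm_ring_1"
  shows "(\<And>i. i \<in> I \<Longrightarrow> f i \<in> free_on B) \<Longrightarrow> sum f I \<in> free_on B"
  by (induction I rule: infinite_finite_induct) (auto intro: add_in_free_on)

lemma basis_expansion: "p = (\<Sum>b\<in>Poly_Mapping.keys p. smul (Poly_Mapping.lookup p b) (basis b))"
  by (rule poly_mapping_eqI)
    (simp add: lookup_sum lookup_single when_def in_keys_iff if_distrib [of "\<lambda>x. _ * x"] cong: if_cong)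

lemma linear_sum_on_free_on:
  fixes scale :: "'r::comm_ring_1 \<Rightarrow> 'm::ab_group_add \<Rightarrow> 'm" and g :: "('b \<Rightarrow>\<^sub>0 'r) \<Rightarrow> 'm"
  assumes "module scale"
    and add: "\<And>x y. x \<in> free_on B \<Longrightarrow> y \<in> free_on B \<Longrightarrow> g (x + y) = g x + g y"
    and smul: "\<And>c x. x \<in> free_on B \<Longrightarrow> g (smul c x) = scale c (g x)"
    and p: "p \<in> free_on B"
  shows "g p = (\<Sum>b\<in>Poly_Mapping.keys p. scale (Poly_Mapping.lookup p b) (g (basis b)))"
proof -
  interpret module scale by fact
  have zero: "g 0 = 0"
    using smul [of 0 0] by simp
  have sum: "g (sum f I) = (\<Sum>i\<in>I. g (f i))" if "\<And>i. i \<in> I \<Longrightarrow> f i \<in> free_on B"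
    for f :: "'b \<Rightarrow> _" and I
    using that
    by (induction I rule: infinite_finite_induct) (auto simp: zero add sum_in_free_on)
  have "g p = g (\<Sum>b\<in>Poly_Mapping.keys p. smul (Poly_Mapping.lookup p b) (basis b))"
    using basis_expansion [of p] by simp
  also have "\<dots> = (\<Sum>b\<in>Poly_Mapping.keys p. g (smul (Poly_Mapping.lookup p b) (basis b)))"
    using p by (intro sum smul_in_free_on basis_in_free_on) (auto simp: free_on_def)
  also have "\<dots> = (\<Sum>b\<in>Poly_Mapping.keys p. scale (Poly_Mapping.lookup p b) (g (basis b)))"
    using p by (intro sum.cong refl smul basis_in_free_on) (auto simp: free_on_def)
  finally show ?thesis .
qed

lemma tensor_product_universal:
  fixes scale :: "'r::comm_ring_1 \<Rightarrow> 'm::ab_group_add \<Rightarrow> 'm"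
    and h :: "('b \<Rightarrow>\<^sub>0 'r) \<Rightarrow> ('c \<Rightarrow>\<^sub>0 'r) \<Rightarrow> 'm"
  assumes "module scale"
    and add_left: "\<And>x x' y. x \<in> free_on B \<Longrightarrow> x' \<in> free_on B \<Longrightarrow> y \<in> free_on C \<Longrightarrow>
           h (x + x') y = h x y + h x' y"
    and add_right: "\<And>x y y'. x \<in> free_on B \<Longrightarrow> y \<in> free_on C \<Longrightarrow> y' \<in> free_on C \<Longrightarrow>
           h x (y + y') = h x y + h x y'"
    and smul_left: "\<And>c x y. x \<in> free_on B \<Longrightarrow> y \<in> free_on C \<Longrightarrow> h (smul c x) y = scale c (h x y)"
    and smul_right: "\<And>c x y. x \<in> free_on B \<Longrightarrow> y \<in> free_on C \<Longrightarrow> h x (smul c y) = scale c (h x y)"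
  shows "\<exists>!g. g \<in> extensional (free_on (B \<times> C)) \<and>
           (\<forall>x\<in>free_on (B \<times> C). \<forall>y\<in>free_on (B \<times> C). g (x + y) = g x + g y) \<and>
           (\<forall>c. \<forall>x\<in>free_on (B \<times> C). g (smul c x) = scale c (g x)) \<and>
           (\<forall>x\<in>free_on B. \<forall>y\<in>free_on C. g (x \<otimes>\<^sub>R y) = h x y)"
proof -
  interpret module scale by fact
  define e where "e p = (\<Sum>d\<in>Poly_Mapping.keys p.
      scale (Poly_Mapping.lookup p d) (h (basis (fst d)) (basis (snd d))))" for p :: "'b \<times> 'c \<Rightarrow>\<^sub>0 'r"
  have e_superset: "e p = (\<Sum>d\<in>S.
      scale (Poly_Mapping.lookup p d) (h (basis (fst d)) (basis (snd d))))"
    if "finite S" "Poly_Mapping.keys p \<subseteq> S" for p S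
    unfolding e_def using that by (intro sum.mono_neutral_left) (auto simp: in_keys_iff)
  have e_add: "e (p + q) = e p + e q" for p q
  proof -
    let ?S = "Poly_Mapping.keys p \<union> Poly_Mapping.keys q"
    have "Poly_Mapping.keys (p + q) \<subseteq> ?S"
      by (rule keys_add)
    then show ?thesis
      by (simp add: e_superset [of ?S] lookup_add scale_left_distrib sum.distrib)
  qed
  have e_smul: "e (smul c p) = scale c (e p)" for c p
  proof -
    have "Poly_Mapping.keys (smul c p) \<subseteq> Poly_Mapping.keys p"
      by (auto simp: in_keys_iff)
    then show ?thesis
      by (simp add: e_superset [of "Poly_Mapping.keys p"] scale_sum_right)
  qed
  have e_tens: "e (x \<otimes>\<^sub>R y) = h x y" if x: "x \<in> free_on B" and y: "y \<in> free_on C" for x y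
  proof -
    have basis_x: "basis b \<in> free_on B" if "b \<in> Poly_Mapping.keys x" for b
      using x that by (auto simp: free_on_def)
    have "h x y = (\<Sum>b\<in>Poly_Mapping.keys x. scale (Poly_Mapping.lookup x b) (h (basis b) y))"
      using y by (intro linear_sum_on_free_on [where g = "\<lambda>x. h x y", OF \<open>module scale\<close> _ _ x])
        (auto simp: add_left smul_left)
    also have "\<dots> = (\<Sum>b\<in>Poly_Mapping.keys x. scale (Poly_Mapping.lookup x b)
        (\<Sum>c\<in>Poly_Mapping.keys y. scale (Poly_Mapping.lookup y c) (h (basis b) (basis c))))"
      by (intro sum.cong refl arg_cong [where f = "scale _"]
          linear_sum_on_free_on [OF \<open>module scale\<close> _ _ y])
        (auto simp: add_right smul_right basis_x)
    also have "\<dots> = (\<Sum>d\<in>Poly_Mapping.keys x \<times> Poly_Mapping.keys y.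
        scale (Poly_Mapping.lookup (x \<otimes>\<^sub>R y) d) (h (basis (fst d)) (basis (snd d))))"
      by (auto simp: scale_sum_right sum.cartesian_product intro!: sum.cong)
    also have "\<dots> = e (x \<otimes>\<^sub>R y)"
      by (intro e_superset [symmetric] keys_tens_subset) auto
    finally show ?thesis by simp
  qed
  show ?thesis
  proof (rule ex1I [of _ "restrict e (free_on (B \<times> C))"], intro conjI)
    show "\<forall>x\<in>free_on B. \<forall>y\<in>free_on C. restrict e (free_on (B \<times> C)) (x \<otimes>\<^sub>R y) = h x y"
    proof (intro ballI)
      fix x :: "'b \<Rightarrow>\<^sub>0 'r" and y :: "'c \<Rightarrow>\<^sub>0 'r"
      assume "x \<in> free_on B" "y \<in> free_on C"
      then show "restrict e (free_on (B \<times> C)) (x \<otimes>\<^sub>R y) = h x y"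
        using keys_tens_subset [of x y] e_tens by (auto simp: free_on_def)
    qed
  next
    fix g
    assume g: "g \<in> extensional (free_on (B \<times> C)) \<and>
           (\<forall>x\<in>free_on (B \<times> C). \<forall>y\<in>free_on (B \<times> C). g (x + y) = g x + g y) \<and>
           (\<forall>c. \<forall>x\<in>free_on (B \<times> C). g (smul c x) = scale c (g x)) \<and>
           (\<forall>x\<in>free_on B. \<forall>y\<in>free_on C. g (x \<otimes>\<^sub>R y) = h x y)"
    have "g p = e p" if p: "p \<in> free_on (B \<times> C)" for p
    proof -
      have "g (basis d) = h (basis (fst d)) (basis (snd d))" if "d \<in> Poly_Mapping.keys p" for d
      proof -
        have "fst d \<in> B" "snd d \<in> C"
          using p that by (auto simp: free_on_def)
        then have "g (basis (fst d) \<otimes>\<^sub>R basis (snd d)) = h (basis (fst d)) (basis (snd d))"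
          using g by (blast intro: basis_in_free_on)
        then show ?thesis
          by (simp add: tens_basis)
      qed
      moreover have "g p = (\<Sum>d\<in>Poly_Mapping.keys p. scale (Poly_Mapping.lookup p d) (g (basis d)))"
        using g by (intro linear_sum_on_free_on [OF \<open>module scale\<close> _ _ p]) auto
      ultimately show ?thesis
        by (simp add: e_def)
    qed
    then show "g = restrict e (free_on (B \<times> C))"
      using g by (auto simp: fun_eq_iff restrict_def extensional_def)
  qed (auto simp: e_add e_smul add_in_free_on smul_in_free_on)
qed

lemma lin_ext_superset:
  assumes "finite S" "Poly_Mapping.keys p \<subseteq> S"
  shows "lin_ext f p = (\<Sum>b\<in>S. smul (Poly_Mapping.lookup p b) (f b))"
  unfolding lin_ext_def using assms by (intro sum.mono_neutral_left) (auto simp: in_keys_iff)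

lemma lin_ext_basis [simp]: "lin_ext f (basis b) = f b"
  by (simp add: lin_ext_superset [of "{b}"])

text \<open>
  The multiplication on \<^typ>\<open>'b \<Rightarrow>\<^sub>0 'r\<close> induced by an additively written monoid \<open>'b\<close> is that of the
  monoid algebra, and the one induced by the product monoid \<open>'b \<times> 'c\<close> is the usual multiplication
  on the tensor product of the two monoid algebras.
\<close>

lemma tens_basis_mult:
  "(basis a \<otimes>\<^sub>R basis a') * (basis b \<otimes>\<^sub>R basis b') =
     (basis a * basis b) \<otimes>\<^sub>R (basis a' * basis b' :: _ \<Rightarrow>\<^sub>0 'r::comm_ring_1)"
  by (simp add: tens_basis mult_single)

lemma tens_one: "1 \<otimes>\<^sub>R 1 = (1 :: 'b::monoid_add \<times> 'c::monoid_add \<Rightarrow>\<^sub>0 'r::comm_ring_1)"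
  by (metis tens_basis single_one zero_prod_def)


section \<open>Bialgebras\<close>

text \<open>
  The predicates below concern the monoid algebra with basis a submonoid \<open>B\<close> of \<open>'b\<close>, i.e.\ the
  algebra \<open>T = free_on B\<close> with multiplication \<open>(*)\<close> and unit \<open>1 = basis 0\<close>. Then \<open>T \<otimes> T\<close> is
  \<open>free_on (B \<times> B)\<close>.
\<close>

definition submonoid :: "'b::monoid_add set \<Rightarrow> bool" where
  "submonoid B \<longleftrightarrow> 0 \<in> B \<and> (\<forall>b\<in>B. \<forall>c\<in>B. b + c \<in> B)"

definition algebra_hom_on ::
  "('b::monoid_add \<Rightarrow>\<^sub>0 'r::comm_ring_1) set \<Rightarrow> ('c::monoid_add \<Rightarrow>\<^sub>0 'r) set \<Rightarrow>
   (('b \<Rightarrow>\<^sub>0 'r) \<Rightarrow> ('c \<Rightarrow>\<^sub>0 'r)) \<Rightarrow> bool" where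
  "algebra_hom_on U V f \<longleftrightarrow>
     f \<in> U \<rightarrow> V \<and> linear_on U f \<and> f 1 = 1 \<and> (\<forall>x\<in>U. \<forall>y\<in>U. f (x * y) = f x * f y)"

definition bialgebra ::
  "'b::monoid_add set \<Rightarrow> (('b \<Rightarrow>\<^sub>0 'r::comm_ring_1) \<Rightarrow> ('b \<times> 'b \<Rightarrow>\<^sub>0 'r)) \<Rightarrow> bool" where
  "bialgebra B \<Delta> \<longleftrightarrow>
     submonoid B \<and>
     \<Delta> \<in> free_on B \<rightarrow> free_on (B \<times> B) \<and>
     linear_on (free_on B) \<Delta> \<and>
     (\<forall>x\<in>free_on B. tensor_assoc (tensor_map \<Delta> id (\<Delta> x)) = tensor_map id \<Delta> (\<Delta> x)) \<and>
     \<Delta> 1 = 1 \<otimes>\<^sub>R 1 \<and>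
     (\<forall>x\<in>free_on B. \<forall>y\<in>free_on B. \<Delta> (x * y) = \<Delta> x * \<Delta> y)"

definition decomposes ::
  "(nat \<Rightarrow> ('b \<Rightarrow>\<^sub>0 'r::comm_ring_1) set) \<Rightarrow> ('b \<Rightarrow>\<^sub>0 'r) \<Rightarrow> (nat \<Rightarrow> ('b \<Rightarrow>\<^sub>0 'r)) \<Rightarrow> bool" where
  "decomposes T p f \<longleftrightarrow>
     (\<forall>m. f m \<in> T m) \<and> finite {m. f m \<noteq> 0} \<and> p = (\<Sum>m | f m \<noteq> 0. f m)"

definition algebra_grading ::
  "'b::monoid_add set \<Rightarrow> (nat \<Rightarrow> ('b \<Rightarrow>\<^sub>0 'r::comm_ring_1) set) \<Rightarrow> bool" where
  "algebra_grading B T \<longleftrightarrow>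
     (\<forall>m. free_mod.subspace (T m) \<and> T m \<subseteq> free_on B) \<and>
     (\<forall>p\<in>free_on B. \<exists>!f. decomposes T p f) \<and>
     1 \<in> T 0 \<and>
     (\<forall>m n. \<forall>x\<in>T m. \<forall>y\<in>T n. x * y \<in> T (m + n))"

text \<open>The projection onto \<open>T m\<close>; meaningful when \<open>T\<close> is a grading.\<close>

definition component ::
  "(nat \<Rightarrow> ('b \<Rightarrow>\<^sub>0 'r::comm_ring_1) set) \<Rightarrow> nat \<Rightarrow> ('b \<Rightarrow>\<^sub>0 'r) \<Rightarrow> ('b \<Rightarrow>\<^sub>0 'r)" where
  "component T m p = (THE f. decomposes T p f) m"

definition positive_part ::
  "(nat \<Rightarrow> ('b \<Rightarrow>\<^sub>0 'r::comm_ring_1) set) \<Rightarrow> ('b \<Rightarrow>\<^sub>0 'r) set" where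
  "positive_part T = free_mod.span (\<Union>m\<in>{1..}. T m)"

definition graded_bialgebra ::
  "'b::monoid_add set \<Rightarrow> (nat \<Rightarrow> ('b \<Rightarrow>\<^sub>0 'r::comm_ring_1) set) \<Rightarrow>
   (('b \<Rightarrow>\<^sub>0 'r) \<Rightarrow> ('b \<times> 'b \<Rightarrow>\<^sub>0 'r)) \<Rightarrow> bool" where
  "graded_bialgebra B T \<Delta> \<longleftrightarrow> bialgebra B \<Delta> \<and> algebra_grading B T"

definition left_handed_graded_bialgebra ::
  "'b::monoid_add set \<Rightarrow> (nat \<Rightarrow> ('b \<Rightarrow>\<^sub>0 'r::comm_ring_1) set) \<Rightarrow>
   (('b \<Rightarrow>\<^sub>0 'r) \<Rightarrow> ('b \<times> 'b \<Rightarrow>\<^sub>0 'r)) \<Rightarrow> bool" where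
  "left_handed_graded_bialgebra B T \<Delta> \<longleftrightarrow>
     graded_bialgebra B T \<Delta> \<and>
     (\<forall>a\<in>T 1. \<Delta> a - a \<otimes>\<^sub>R 1 - 1 \<otimes>\<^sub>R a \<in> tensor_sub (positive_part T) (T 1))"

definition leading_term ::
  "(nat \<Rightarrow> ('b \<Rightarrow>\<^sub>0 'r::comm_ring_1) set) \<Rightarrow> (('b \<Rightarrow>\<^sub>0 'r) \<Rightarrow> ('b \<times> 'b \<Rightarrow>\<^sub>0 'r)) \<Rightarrow>
   ('b \<Rightarrow>\<^sub>0 'r) \<Rightarrow> ('b \<times> 'b \<Rightarrow>\<^sub>0 'r)" where
  "leading_term T \<Delta> =
     restrict (\<lambda>a. tensor_map (component T 1) (component T 1) (\<Delta> a)) (T 1)"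


section \<open>Words and phrases\<close>

type_synonym 'a word = "'a list"
type_synonym 'a phrase = "'a word list"

text \<open>
  Lists form a monoid under concatenation, written additively as required by the multiplication
  on \<^typ>\<open>'b \<Rightarrow>\<^sub>0 'r\<close>.
\<close>

instantiation list :: (type) monoid_add
begin

definition zero_list :: "'a list" where
  "0 = []"

definition plus_list :: "'a list \<Rightarrow> 'a list \<Rightarrow> 'a list" where
  "xs + ys = xs @ ys"

instance
  by standard (simp_all add: zero_list_def plus_list_def)

end

definition phrases :: "'a set \<Rightarrow> 'a phrase set" where
  "phrases A = lists (lists A)"

definition word_module :: "'a set \<Rightarrow> ('a word \<Rightarrow>\<^sub>0 'r::comm_ring_1) set" where
  "word_module A = free_on (lists A)"

definition phrase_algebra :: "'a set \<Rightarrow> ('a phrase \<Rightarrow>\<^sub>0 'r::comm_ring_1) set" where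
  "phrase_algebra A = free_on (phrases A)"

definition phrase_grading :: "'a set \<Rightarrow> nat \<Rightarrow> ('a phrase \<Rightarrow>\<^sub>0 'r::comm_ring_1) set" where
  "phrase_grading A m = free_on {p \<in> phrases A. length p = m}"

lemma phrase_mult: "basis p * basis q = (basis (p @ q) :: 'a phrase \<Rightarrow>\<^sub>0 'r::comm_ring_1)"
  and phrase_one: "1 = (basis [] :: 'a phrase \<Rightarrow>\<^sub>0 'r::comm_ring_1)"
  by (simp_all add: mult_single plus_list_def flip: zero_list_def)

text \<open>The identification of a word \<open>w\<close> with the one-word phrase \<open>(w)\<close>.\<close>

definition one_word :: "('a word \<Rightarrow>\<^sub>0 'r) \<Rightarrow> ('a phrase \<Rightarrow>\<^sub>0 'r::comm_ring_1)" where
  "one_word = lin_ext (\<lambda>w. basis [w])"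

text \<open>Positions in a word are counted from 1.\<close>

definition letter :: "'a word \<Rightarrow> nat \<Rightarrow> 'a" where
  "letter w i = w ! (i - 1)"

text \<open>\<open>w\<^bsub>i,j\<^esub> = w(i) \<dots> w(j - 1)\<close>, for \<open>1 \<le> i \<le> j \<le> length w + 1\<close>.\<close>

definition subword :: "'a word \<Rightarrow> nat \<Rightarrow> nat \<Rightarrow> 'a word" where
  "subword w i j = map (letter w) [i..<j]"


section \<open>Inscriptions\<close>

definition inscriptions :: "'a word \<Rightarrow> nat set set" where
  "inscriptions w = {\<alpha>. \<alpha> \<subseteq> {1..length w} \<and> even (card \<alpha>)}"

definition insc_length :: "nat set \<Rightarrow> nat" where
  "insc_length \<alpha> = card \<alpha> div 2"

text \<open>
  An inscription of length \<open>k\<close> is written as \<open>i\<^sub>1 < j\<^sub>1 < \<dots> < i\<^sub>k < j\<^sub>k\<close>. By convention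
  \<open>j\<^sub>0 = 0\<close> and \<open>i\<^bsub>k + 1\<^esub> = length w + 1\<close>, so that the word \<open>r\<^sub>\<alpha>(w)\<close> is the concatenation of
  the words \<open>w\<close> from \<open>j\<^sub>u + 1\<close> up to \<open>i\<^bsub>u + 1\<^esub>\<close> (exclusive) for \<open>u = 0, \<dots>, k\<close>.
\<close>

definition insc_i :: "'a word \<Rightarrow> nat set \<Rightarrow> nat \<Rightarrow> nat" where
  "insc_i w \<alpha> u =
     (if u \<le> insc_length \<alpha> then sorted_list_of_set \<alpha> ! (2 * u - 2) else length w + 1)"

definition insc_j :: "nat set \<Rightarrow> nat \<Rightarrow> nat" where
  "insc_j \<alpha> u = (if u = 0 then 0 else sorted_list_of_set \<alpha> ! (2 * u - 1))"

definition insc_left :: "'a word \<Rightarrow> nat set \<Rightarrow> 'a phrase" where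
  "insc_left w \<alpha> =
     map (\<lambda>u. subword w (insc_i w \<alpha> u + 1) (insc_j \<alpha> u)) [1..<insc_length \<alpha> + 1]"

definition insc_right :: "'a word \<Rightarrow> nat set \<Rightarrow> 'a word" where
  "insc_right w \<alpha> =
     concat (map (\<lambda>u. subword w (insc_j \<alpha> u + 1) (insc_i w \<alpha> (u + 1))) [0..<insc_length \<alpha> + 1])"

definition insc_weight ::
  "('a \<Rightarrow> 'a \<Rightarrow> 'r::comm_ring_1) \<Rightarrow> 'a word \<Rightarrow> nat set \<Rightarrow> 'r" where
  "insc_weight \<mu> w \<alpha> =
     (\<Prod>u = 1..insc_length \<alpha>. \<mu> (letter w (insc_i w \<alpha> u)) (letter w (insc_j \<alpha> u)))"


section \<open>The comultiplication and its leading term\<close>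

definition rho ::
  "('a \<Rightarrow> 'a \<Rightarrow> 'r) \<Rightarrow> ('a word \<Rightarrow>\<^sub>0 'r) \<Rightarrow> ('a word \<times> 'a word \<Rightarrow>\<^sub>0 'r::comm_ring_1)" where
  "rho \<mu> = lin_ext (\<lambda>w. \<Sum>(i, j)\<in>{(i, j). 1 \<le> i \<and> i < j \<and> j \<le> length w}.
     smul (\<mu> (letter w i) (letter w j))
       (basis (subword w (i + 1) j) \<otimes>\<^sub>R
        basis (subword w 1 i @ subword w (j + 1) (length w + 1))))"

definition phrase_coproduct ::
  "'a set \<Rightarrow> ('a \<Rightarrow> 'a \<Rightarrow> 'r::comm_ring_1) \<Rightarrow>
   (('a phrase \<Rightarrow>\<^sub>0 'r) \<Rightarrow> ('a phrase \<times> 'a phrase \<Rightarrow>\<^sub>0 'r)) \<Rightarrow> bool" where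
  "phrase_coproduct A \<mu> \<Delta> \<longleftrightarrow>
     algebra_hom_on (phrase_algebra A) (free_on (phrases A \<times> phrases A)) \<Delta> \<and>
     (\<forall>w\<in>lists A.
        \<Delta> (basis [w]) = basis [w] \<otimes>\<^sub>R 1 +
          (\<Sum>\<alpha>\<in>inscriptions w.
             smul (insc_weight \<mu> w \<alpha>) (basis (insc_left w \<alpha>) \<otimes>\<^sub>R basis [insc_right w \<alpha>])))"

end

theory Submission
  imports Defs
begin

text \<open>
  Reading a word from the left, an inscription in \<open>xw\<close> either avoids \<open>x\<close> or has a first arc from
  \<open>x\<close> to some letter \<open>y\<close> of \<open>w = uyv\<close>. Writing \<open>\<Delta>(w) = w \<otimes> 1 + D(w)\<close>, this gives
  \<open>D(xw) = (1 \<otimes> x) D(w) + \<Sum> \<mu>(x, y) (u \<otimes> 1) D(v)\<close>. With this recursion, coassociativity, which on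
  words amounts to \<open>(\<Delta> \<otimes> id) D = (id \<otimes> D) D\<close>, follows by induction on the length of the word,
  because an inscription in \<open>w\<close> together with a letter of \<open>r\<^sub>\<alpha>(w)\<close> is a factorisation
  \<open>w = uyv\<close> together with inscriptions in \<open>u\<close> and in \<open>v\<close>. To make the inductions uniform, elements of
  tensor products are replaced by the sums \<open>\<Sum> \<mu>(w, \<alpha>) f(l\<^sub>\<alpha>(w), r\<^sub>\<alpha>(w))\<close> for arbitrary \<open>f\<close>.
\<close>

section \<open>Sums over inscriptions\<close>

text \<open>For k = 0 these are the inscriptions in a word of length m. A larger k confines the arcs
  to positions after k, still numbered as in the whole word.\<close>

definition even_subsets :: "nat \<Rightarrow> nat \<Rightarrow> nat set set" where
  "even_subsets k m = {\<alpha>. \<alpha> \<subseteq> {Suc k..m} \<and> even (card \<alpha>)}"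

lemma finite_even_subsets [simp]: "finite (even_subsets k m)"
  by (rule finite_subset [of _ "Pow {Suc k..m}"]) (auto simp: even_subsets_def)

lemma even_subsets_self [simp]: "even_subsets m m = {{}}"
  by (auto simp: even_subsets_def)

text \<open>Either \<open>Suc k\<close> is not in \<alpha>, or it opens the first arc. By parity
  other elements remain; the least of them is the end j of the arc, and the rest is an even subset
  beyond j.\<close>

lemma sum_even_subsets:
  fixes F :: "nat set \<Rightarrow> 'm::ab_group_add"
  assumes "k < m"
  shows "sum F (even_subsets k m) = sum F (even_subsets (Suc k) m) +
    (\<Sum>j\<in>{k + 2..m}. \<Sum>\<beta>\<in>even_subsets j m. F (insert (Suc k) (insert j \<beta>)))"
proof -
  let ?I = "even_subsets k m" and ?N = "{\<alpha>. Suc k \<in> \<alpha>}"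
  have "{Suc (Suc k)..m} = {Suc k..m} - {Suc k}"
    by auto
  then have out: "?I - ?N = even_subsets (Suc k) m"
    by (auto simp: even_subsets_def)
  have "sum F (?I \<inter> ?N) =
      (\<Sum>(j, \<beta>)\<in>Sigma {k + 2..m} (\<lambda>j. even_subsets j m). F (insert (Suc k) (insert j \<beta>)))"
  proof (rule sum.reindex_bij_witness
      [where i = "\<lambda>(j, \<beta>). insert (Suc k) (insert j \<beta>)"
         and j = "\<lambda>\<alpha>. (Min (\<alpha> - {Suc k}), \<alpha> - {Suc k, Min (\<alpha> - {Suc k})})"])
    fix \<alpha> assume a: "\<alpha> \<in> ?I \<inter> ?N"
    let ?c = "\<alpha> - {Suc k}"
    have fin: "finite \<alpha>"
      using a by (auto simp: even_subsets_def intro: finite_subset)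
    have card: "card \<alpha> = Suc (card ?c)" "odd (card ?c)"
      using a fin card.remove [of \<alpha> "Suc k"] by (auto simp: even_subsets_def)
    then have "?c \<noteq> {}" by (metis card.empty even_zero)
    then have min: "Min ?c \<in> ?c" using fin by (intro Min_in) auto
    have less: "Min ?c < x" if "x \<in> ?c" "x \<noteq> Min ?c" for x
    proof -
      have "Min ?c \<le> x" using fin that(1) by (intro Min_le) auto
      with that(2) show ?thesis by simp
    qed
    show eq: "(case (Min ?c, \<alpha> - {Suc k, Min ?c}) of
        (j, \<beta>) \<Rightarrow> insert (Suc k) (insert j \<beta>)) = \<alpha>"
      using a min by auto
    have "card ?c = Suc (card (?c - {Min ?c}))"
      using min fin card.remove [of ?c "Min ?c"] by auto
    moreover have "?c - {Min ?c} = \<alpha> - {Suc k, Min ?c}" by auto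
    ultimately have "even (card (\<alpha> - {Suc k, Min ?c}))"
      using card by (metis even_Suc)
    moreover have "\<alpha> - {Suc k, Min ?c} \<subseteq> {Suc (Min ?c)..m}"
    proof
      fix x assume x: "x \<in> \<alpha> - {Suc k, Min ?c}"
      then have "Min ?c < x" by (intro less) auto
      moreover have "x \<le> m" using a x by (auto simp: even_subsets_def)
      ultimately show "x \<in> {Suc (Min ?c)..m}" by simp
    qed
    moreover have "Min ?c \<in> {k + 2..m}"
    proof -
      have "Min ?c \<in> {Suc k..m}" "Min ?c \<noteq> Suc k"
        using a min by (auto simp only: even_subsets_def)
      then show ?thesis by simp
    qed
    ultimately show "(Min ?c, \<alpha> - {Suc k, Min ?c}) \<in> Sigma {k + 2..m} (\<lambda>j. even_subsets j m)"
      by (auto simp: even_subsets_def)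
    show "(case (Min ?c, \<alpha> - {Suc k, Min ?c}) of (j, \<beta>) \<Rightarrow> F (insert (Suc k) (insert j \<beta>))) = F \<alpha>"
      using eq by simp
  next
    fix q assume "q \<in> Sigma {k + 2..m} (\<lambda>j. even_subsets j m)"
    then obtain j \<beta> where q: "q = (j, \<beta>)" "k + 2 \<le> j" "j \<le> m" "\<beta> \<subseteq> {Suc j..m}" "even (card \<beta>)"
      by (auto simp: even_subsets_def)
    have fin: "finite \<beta>" using q by (auto intro: finite_subset)
    have notin: "j \<notin> \<beta>" "Suc k \<notin> insert j \<beta>"
      using q by auto
    then have c: "insert (Suc k) (insert j \<beta>) - {Suc k} = insert j \<beta>"
      by auto
    have min: "Min (insert j \<beta>) = j"
      using q fin by (intro Min_eqI) auto
    show "(\<lambda>\<alpha>. (Min (\<alpha> - {Suc k}), \<alpha> - {Suc k, Min (\<alpha> - {Suc k})}))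
        (case q of (j, \<beta>) \<Rightarrow> insert (Suc k) (insert j \<beta>)) = q"
      using notin by (auto simp: q(1) c min)
    show "(case q of (j, \<beta>) \<Rightarrow> insert (Suc k) (insert j \<beta>)) \<in> ?I \<inter> ?N"
      using q notin fin by (auto simp: even_subsets_def)
  qed
  also have "\<dots> = (\<Sum>j\<in>{k + 2..m}. \<Sum>\<beta>\<in>even_subsets j m. F (insert (Suc k) (insert j \<beta>)))"
    by (intro sum.Sigma [symmetric]) auto
  finally have "sum F (?I \<inter> ?N) =
      (\<Sum>j\<in>{k + 2..m}. \<Sum>\<beta>\<in>even_subsets j m. F (insert (Suc k) (insert j \<beta>)))" .
  moreover have "sum F ?I = sum F (?I \<inter> ?N) + sum F (?I - ?N)"
    by (rule sum.Int_Diff) simp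
  ultimately show ?thesis
    unfolding out by (simp only: add.commute)
qed

section \<open>Removing the first arc of an inscription\<close>

lemma insc_arc:
  assumes "i < j" and "\<beta> \<subseteq> {Suc j..m}"
  shows sorted_list_arc: "sorted_list_of_set (insert i (insert j \<beta>)) = i # j # sorted_list_of_set \<beta>"
    and insc_length_arc: "insc_length (insert i (insert j \<beta>)) = Suc (insc_length \<beta>)"
proof -
  have fin: "finite \<beta>" using assms by (auto intro: finite_subset)
  have "insert i (insert j \<beta>) = set (i # j # sorted_list_of_set \<beta>)"
    using fin by simp
  moreover have "sorted (i # j # sorted_list_of_set \<beta>)" "distinct (i # j # sorted_list_of_set \<beta>)"
    using assms fin by auto
  ultimately show "sorted_list_of_set (insert i (insert j \<beta>)) = i # j # sorted_list_of_set \<beta>"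
    by (metis sorted_list_of_set.idem_if_sorted_distinct)
  have "i \<notin> insert j \<beta>" "j \<notin> \<beta>"
    using assms by auto
  then have "card (insert i (insert j \<beta>)) = Suc (Suc (card \<beta>))"
    using fin by simp
  then show "insc_length (insert i (insert j \<beta>)) = Suc (insc_length \<beta>)"
    by (simp add: insc_length_def)
qed

text \<open>The new arc takes the first two places of the sorted list, so the arcs of \<beta> are
  renumbered by one. As \<open>insc_length\<close> also grows by one, the default
  \<open>length w + 1\<close> of \<open>insc_i\<close> shifts along with them.\<close>

lemma insc_arc_positions:
  assumes "i < j" and "\<beta> \<subseteq> {Suc j..m}"
  defines "\<alpha> \<equiv> insert i (insert j \<beta>)"
  shows "insc_i w \<alpha> (Suc 0) = i" and "insc_j \<alpha> (Suc 0) = j"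
    and "insc_i w \<alpha> (Suc (Suc u)) = insc_i w \<beta> (Suc u)"
    and "insc_j \<alpha> (Suc (Suc u)) = insc_j \<beta> (Suc u)"
  using insc_arc [OF assms(1,2)] by (simp_all add: \<alpha>_def insc_i_def insc_j_def)

lemma map_upt_one: "map f [1..<n + 1] = map (\<lambda>u. f (Suc u)) [0..<n]"
  by (rule nth_equalityI) (auto simp del: upt_Suc)

lemma insc_left_arc:
  assumes "i < j" and "\<beta> \<subseteq> {Suc j..m}"
  shows "insc_left w (insert i (insert j \<beta>)) = subword w (Suc i) j # insc_left w \<beta>"
  unfolding insc_left_def map_upt_one insc_length_arc [OF assms] map_upt_Suc
  by (simp add: insc_arc_positions [OF assms])

lemma insc_weight_arc:
  assumes "i < j" and "\<beta> \<subseteq> {Suc j..m}"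
  shows "insc_weight \<mu> w (insert i (insert j \<beta>)) = \<mu> (letter w i) (letter w j) * insc_weight \<mu> w \<beta>"
proof -
  have "insc_weight \<mu> w \<gamma> = (\<Prod>u<insc_length \<gamma>. \<mu> (letter w (insc_i w \<gamma> (Suc u))) (letter w (insc_j \<gamma> (Suc u))))"
    for \<gamma>
    unfolding insc_weight_def by (simp add: prod.atLeast1_atMost_eq)
  then show ?thesis
    by (simp add: insc_arc [OF assms] insc_arc_positions [OF assms] prod.lessThan_Suc_shift del: prod.lessThan_Suc)
qed

text \<open>The part of \<open>r\<^sub>\<alpha>(w)\<close> after position \<open>k\<close>. Keeping \<open>w\<close> and moving \<open>k\<close> lets the first arc be
  removed from \<open>\<alpha>\<close> without renumbering the other positions.\<close>

definition insc_right_from :: "nat \<Rightarrow> 'a word \<Rightarrow> nat set \<Rightarrow> 'a word" where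
  "insc_right_from k w \<alpha> = subword w (Suc k) (insc_i w \<alpha> 1) @
     concat (map (\<lambda>u. subword w (Suc (insc_j \<alpha> (Suc u))) (insc_i w \<alpha> (Suc (Suc u)))) [0..<insc_length \<alpha>])"

lemma insc_right_from_0: "insc_right w \<alpha> = insc_right_from 0 w \<alpha>"
  unfolding insc_right_def insc_right_from_def Suc_eq_plus1 [symmetric] map_upt_Suc
  by (simp add: insc_j_def)

text \<open>The letters between i and j go to \<open>insc_left\<close>, so the right word resumes
  after j.\<close>

lemma insc_right_from_arc:
  assumes "i < j" and "\<beta> \<subseteq> {Suc j..m}"
  shows "insc_right_from k w (insert i (insert j \<beta>)) = subword w (Suc k) i @ insc_right_from j w \<beta>"
  unfolding insc_right_from_def insc_length_arc [OF assms] map_upt_Suc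
  by (simp add: insc_arc_positions [OF assms])

lemma subword_empty [simp]: "j \<le> i \<Longrightarrow> subword w i j = []"
  and subword_Cons: "i < j \<Longrightarrow> subword w i j = letter w i # subword w (Suc i) j"
  by (simp_all add: subword_def upt_conv_Cons)

text \<open>No arc of \<beta> touches \<open>Suc k\<close>, so this letter begins the first block of
  the right word.\<close>

lemma insc_right_from_skip:
  assumes "k < length w" and "\<beta> \<in> even_subsets (Suc k) (length w)"
  shows "insc_right_from k w \<beta> = letter w (Suc k) # insc_right_from (Suc k) w \<beta>"
proof -
  have "Suc k < insc_i w \<beta> 1"
  proof (cases "insc_length \<beta> = 0")
    case True
    \<comment> \<open>Without arcs the first block ends at the default
      \<open>length w + 1\<close>.\<close>
    then show ?thesis using assms by (simp add: insc_i_def)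
  next
    case False
    have fin: "finite \<beta>"
      using assms by (auto simp: even_subsets_def intro: finite_subset)
    with False have "sorted_list_of_set \<beta> ! 0 \<in> set (sorted_list_of_set \<beta>)"
      by (intro nth_mem) (auto simp: insc_length_def)
    then show ?thesis
      using False assms fin by (auto simp: insc_i_def even_subsets_def)
  qed
  then show ?thesis
    by (simp add: insc_right_from_def subword_Cons)
qed

text \<open>With \<open>f l r = basis (l, [r])\<close> this is D(w).\<close>

definition insc_sum ::
  "('a \<Rightarrow> 'a \<Rightarrow> 'r::comm_ring_1) \<Rightarrow> 'a word \<Rightarrow> ('a phrase \<Rightarrow> 'a word \<Rightarrow> 'b \<Rightarrow>\<^sub>0 'r) \<Rightarrow> ('b \<Rightarrow>\<^sub>0 'r)" where
  "insc_sum \<mu> w f = (\<Sum>\<alpha>\<in>inscriptions w. smul (insc_weight \<mu> w \<alpha>) (f (insc_left w \<alpha>) (insc_right w \<alpha>)))"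

text \<open>Runs over the factorisations w = uyv with one marked letter y.\<close>

definition split_sum :: "'a word \<Rightarrow> ('a word \<Rightarrow> 'a \<Rightarrow> 'a word \<Rightarrow> 'm::ab_group_add) \<Rightarrow> 'm" where
  "split_sum w h = (\<Sum>i<length w. h (take i w) (w ! i) (drop (Suc i) w))"

text \<open>Interpolates between w and its suffix \<open>drop k w\<close>: only the part after
  position k counts, but positions still refer to w.\<close>

definition insc_sum_from ::
  "('a \<Rightarrow> 'a \<Rightarrow> 'r::comm_ring_1) \<Rightarrow> nat \<Rightarrow> 'a word \<Rightarrow> ('a phrase \<Rightarrow> 'a word \<Rightarrow> 'b \<Rightarrow>\<^sub>0 'r) \<Rightarrow> ('b \<Rightarrow>\<^sub>0 'r)" where
  "insc_sum_from \<mu> k w f = (\<Sum>\<alpha>\<in>even_subsets k (length w).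
     smul (insc_weight \<mu> w \<alpha>) (f (insc_left w \<alpha>) (insc_right_from k w \<alpha>)))"

lemma insc_sum_from_0: "insc_sum \<mu> w f = insc_sum_from \<mu> 0 w f"
  by (simp add: insc_sum_def insc_sum_from_def insc_right_from_0 inscriptions_def even_subsets_def)

lemma subword_take_drop:
  assumes "j \<le> length w"
  shows "subword w (Suc i) (Suc j) = take (j - i) (drop i w)"
  using assms by (intro nth_equalityI) (auto simp: subword_def letter_def simp del: upt_Suc)

lemma split_sum_drop:
  "split_sum (drop k w) h =
     (\<Sum>j\<in>{Suc k..length w}. h (subword w (Suc k) j) (letter w j) (drop j w))"
  unfolding split_sum_def
  by (rule sum.reindex_bij_witness [where i = "\<lambda>j. j - Suc k" and j = "\<lambda>i. Suc (k + i)"])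
    (auto simp: subword_take_drop letter_def add.commute)

lemma insc_sum_from_end: "insc_sum_from \<mu> (length w) w f = f [] []"
  by (simp add: insc_sum_from_def insc_weight_def insc_left_def insc_right_from_def insc_length_def insc_i_def)

text \<open>The letter at \<open>Suc k\<close> either passes to the right word or is joined to a
  letter at j; in the second case the subword between them heads the left phrase.\<close>

lemma insc_sum_from_step:
  assumes "k < length w"
  shows "insc_sum_from \<mu> k w f = insc_sum_from \<mu> (Suc k) w (\<lambda>l r. f l (letter w (Suc k) # r)) +
    (\<Sum>j\<in>{k + 2..length w}. smul (\<mu> (letter w (Suc k)) (letter w j))
        (insc_sum_from \<mu> j w (\<lambda>l r. f (subword w (k + 2) j # l) r)))"
proof -
  have *: "(\<Sum>\<beta>\<in>even_subsets j (length w). smul (insc_weight \<mu> w (insert (Suc k) (insert j \<beta>)))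
       (f (insc_left w (insert (Suc k) (insert j \<beta>))) (insc_right_from k w (insert (Suc k) (insert j \<beta>))))) =
     smul (\<mu> (letter w (Suc k)) (letter w j)) (insc_sum_from \<mu> j w (\<lambda>l r. f (subword w (k + 2) j # l) r))"
    if "j \<in> {k + 2..length w}" for j
    unfolding insc_sum_from_def free_mod.scale_sum_right
  proof (rule sum.cong)
    fix \<beta> assume "\<beta> \<in> even_subsets j (length w)"
    then have 2: "Suc k < j" "\<beta> \<subseteq> {Suc j..length w}"
      using that by (auto simp: even_subsets_def)
    show "smul (insc_weight \<mu> w (insert (Suc k) (insert j \<beta>)))
       (f (insc_left w (insert (Suc k) (insert j \<beta>))) (insc_right_from k w (insert (Suc k) (insert j \<beta>)))) =
      smul (\<mu> (letter w (Suc k)) (letter w j)) (smul (insc_weight \<mu> w \<beta>)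
       (f (subword w (k + 2) j # insc_left w \<beta>) (insc_right_from j w \<beta>)))"
      by (simp add: insc_left_arc [OF 2] insc_weight_arc [OF 2] insc_right_from_arc [OF 2])
  qed simp
  show ?thesis
    unfolding insc_sum_from_def [of _ k] sum_even_subsets [OF assms]
    using * by (simp add: insc_sum_from_def [of _ "Suc k"] insc_right_from_skip [OF assms])
qed

text \<open>The assumption \<open>IH\<close> is \<open>insc_sum_from_drop\<close> for later
  positions. Isolating it lets this step serve both inside the induction for that lemma and again
  after it.\<close>

lemma insc_sum_from_step_split:
  fixes f :: "'a phrase \<Rightarrow> 'a word \<Rightarrow> 'b \<Rightarrow>\<^sub>0 'r::comm_ring_1"
  assumes k: "k < length w"
    and IH: "\<And>j (f :: 'a phrase \<Rightarrow> 'a word \<Rightarrow> 'b \<Rightarrow>\<^sub>0 'r).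
      k < j \<Longrightarrow> j \<le> length w \<Longrightarrow> insc_sum_from \<mu> j w f = insc_sum \<mu> (drop j w) f"
  shows "insc_sum_from \<mu> k w f = insc_sum \<mu> (drop (Suc k) w) (\<lambda>l r. f l (w ! k # r)) +
     split_sum (drop (Suc k) w) (\<lambda>u y v. smul (\<mu> (w ! k) y) (insc_sum \<mu> v (\<lambda>l r. f (u # l) r)))"
  unfolding insc_sum_from_step [OF k] split_sum_drop
  using k by (auto simp: IH letter_def intro!: arg_cong2 [where f = plus] sum.cong)

text \<open>Both sides obey the recursion of \<open>insc_sum_from_step_split\<close>, the right one
  for the word \<open>drop k w\<close> at position 0, and both recursions lead to the same shorter
  suffixes. So no inscription has to be renumbered.\<close>

lemma insc_sum_from_drop:
  fixes f :: "'a phrase \<Rightarrow> 'a word \<Rightarrow> 'b \<Rightarrow>\<^sub>0 'r::comm_ring_1"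
  shows "k \<le> length w \<Longrightarrow> insc_sum_from \<mu> k w f = insc_sum \<mu> (drop k w) f"
proof (induction "length w - k" arbitrary: k w f rule: less_induct)
  case less
  show ?case
  proof (cases "k = length w")
    case True
    then show ?thesis
      using insc_sum_from_end [of \<mu> w f] insc_sum_from_end [of \<mu> "[]" f] by (simp add: insc_sum_from_0)
  next
    case False
    then have k: "k < length w" using less.prems by simp
    have 1: "insc_sum_from \<mu> j w f = insc_sum \<mu> (drop j w) f"
      if "k < j" "j \<le> length w" for j and f :: "_ \<Rightarrow> _ \<Rightarrow> 'b \<Rightarrow>\<^sub>0 'r"
      using that k by (intro less.hyps) auto
    \<comment> \<open>Here the word itself changes to \<open>drop k w\<close>; the measure still
      falls because 0 < j.\<close>
    have 2: "insc_sum_from \<mu> j (drop k w) f = insc_sum \<mu> (drop j (drop k w)) f"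
      if "0 < j" "j \<le> length (drop k w)" for j and f :: "_ \<Rightarrow> _ \<Rightarrow> 'b \<Rightarrow>\<^sub>0 'r"
      using that k by (intro less.hyps) auto
    show ?thesis
      using insc_sum_from_step_split [OF k 1, where f = f]
        insc_sum_from_step_split [where k = 0, OF _ 2, where f = f] k
      by (simp add: insc_sum_from_0 [of _ "drop k w"])
  qed
qed

lemma insc_sum_Nil [simp]: "insc_sum \<mu> [] f = f [] []"
  using insc_sum_from_end [of \<mu> "[]" f] by (simp add: insc_sum_from_0)

text \<open>The recursion for D. The later inductions on words see inscriptions only through
  it.\<close>

lemma insc_sum_Cons:
  "insc_sum \<mu> (x # w) f = insc_sum \<mu> w (\<lambda>l r. f l (x # r)) +
     split_sum w (\<lambda>u y v. smul (\<mu> x y) (insc_sum \<mu> v (\<lambda>l r. f (u # l) r)))"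
  using insc_sum_from_step_split [of 0 "x # w", OF _ insc_sum_from_drop, of \<mu> f]
  by (simp add: insc_sum_from_0 [of \<mu> "x # w"])

section \<open>Calculus of sums over factorisations and inscriptions\<close>

lemma split_sum_Nil [simp]: "split_sum [] h = 0"
  by (simp add: split_sum_def)

lemma split_sum_Cons [simp]:
  "split_sum (x # w) h = h [] x w + split_sum w (\<lambda>u y v. h (x # u) y v)"
  by (simp add: split_sum_def sum.lessThan_Suc_shift del: sum.lessThan_Suc)

lemma split_sum_cong:
  assumes "\<And>u y v. w = u @ y # v \<Longrightarrow> h u y v = h' u y v"
  shows "split_sum w h = split_sum w h'"
  using assms by (auto simp: split_sum_def id_take_nth_drop intro!: sum.cong)

lemma split_sum_add:
  "split_sum w (\<lambda>u y v. h u y v + h' u y v) = split_sum w h + split_sum w h'"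
  by (simp add: split_sum_def sum.distrib)

lemma split_sum_smul:
  "split_sum w (\<lambda>u y v. smul c (h u y v)) = smul c (split_sum w h)"
  by (simp add: split_sum_def free_mod.scale_sum_right)

text \<open>Both sides mark two letters of w; they differ in which of the two is marked
  first.\<close>

lemma split_sum_split_sum:
  "split_sum w (\<lambda>u y v. split_sum v (\<lambda>v' z v''. h u y v' z v'')) =
   split_sum w (\<lambda>u z v. split_sum u (\<lambda>u' y u''. h u' y u'' z v))"
  by (induction w arbitrary: h) (simp_all add: split_sum_add)

lemma insc_sum_hom:
  assumes "module_hom smul smul h"
  shows "h (insc_sum \<mu> w f) = insc_sum \<mu> w (\<lambda>l r. h (f l r))"
proof -
  interpret module_hom smul smul h by fact
  show ?thesis by (simp add: insc_sum_def sum scale)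
qed

lemma insc_sum_add: "insc_sum \<mu> w (\<lambda>l r. f l r + g l r) = insc_sum \<mu> w f + insc_sum \<mu> w g"
  by (simp add: insc_sum_def sum.distrib free_mod.scale_right_distrib)

lemma insc_sum_zero [simp]: "insc_sum \<mu> w (\<lambda>l r. 0) = 0"
  by (simp add: insc_sum_def)

lemma insc_sum_smul: "insc_sum \<mu> w (\<lambda>l r. smul c (f l r)) = smul c (insc_sum \<mu> w f)"
  by (rule insc_sum_hom [symmetric]) (rule free_mod.module_hom_scale_self)

lemma insc_sum_swap:
  "insc_sum \<mu> w (\<lambda>l r. insc_sum \<mu> u (\<lambda>a b. f l r a b)) =
   insc_sum \<mu> u (\<lambda>a b. insc_sum \<mu> w (\<lambda>l r. f l r a b))"
  unfolding insc_sum_def free_mod.scale_sum_right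
  by (subst sum.swap) (simp add: mult.commute)

text \<open>A letter of \<open>r\<^sub>\<alpha>(w)\<close> lies under no arc of \<open>\<alpha>\<close>, so it cuts \<open>\<alpha>\<close> into inscriptions in the
  parts of \<open>w\<close> on its two sides.\<close>

lemma insc_sum_split_right:
  fixes g :: "'a phrase \<Rightarrow> 'a word \<Rightarrow> 'a \<Rightarrow> 'a word \<Rightarrow> 'b \<Rightarrow>\<^sub>0 'r::comm_ring_1"
  shows "insc_sum \<mu> w (\<lambda>l r. split_sum r (\<lambda>s y t. g l s y t)) =
   split_sum w (\<lambda>u y v. insc_sum \<mu> u (\<lambda>l r. insc_sum \<mu> v (\<lambda>l' r'. g (l @ l') r y r')))"
proof (induction w arbitrary: g rule: length_induct)
  case (1 w)
  show ?case
  proof (cases w)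
    case (Cons x w')
    have IH: "insc_sum \<mu> v (\<lambda>l r. split_sum r (\<lambda>s y t. g l s y t)) =
        split_sum v (\<lambda>u y v. insc_sum \<mu> u (\<lambda>l r. insc_sum \<mu> v (\<lambda>l' r'. g (l @ l') r y r')))"
      if "length v \<le> length w'" for v and g :: "'a phrase \<Rightarrow> 'a word \<Rightarrow> 'a \<Rightarrow> 'a word \<Rightarrow> 'b \<Rightarrow>\<^sub>0 'r"
      using that 1 Cons by simp
    \<comment> \<open>Three cases: x is the marked letter, x precedes it in the right word, or x
      opens an arc to y and the marked letter lies beyond y.\<close>
    have "insc_sum \<mu> w (\<lambda>l r. split_sum r (g l)) =
      insc_sum \<mu> w' (\<lambda>l r. g l [] x r) + insc_sum \<mu> w' (\<lambda>l r. split_sum r (\<lambda>s y t. g l (x # s) y t)) +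
      split_sum w' (\<lambda>u y v. smul (\<mu> x y) (insc_sum \<mu> v (\<lambda>l r. split_sum r (\<lambda>s z t. g (u # l) s z t))))"
      by (simp add: Cons insc_sum_Cons insc_sum_add)
    also have "split_sum w' (\<lambda>u y v. smul (\<mu> x y) (insc_sum \<mu> v (\<lambda>l r. split_sum r (\<lambda>s z t. g (u # l) s z t)))) =
      split_sum w' (\<lambda>u y v. split_sum v (\<lambda>v' z v''. smul (\<mu> x y)
        (insc_sum \<mu> v' (\<lambda>l r. insc_sum \<mu> v'' (\<lambda>l' r'. g (u # l @ l') r z r')))))"
      by (rule split_sum_cong) (simp add: IH split_sum_smul)
    also have "insc_sum \<mu> w' (\<lambda>l r. split_sum r (\<lambda>s y t. g l (x # s) y t)) =
      split_sum w' (\<lambda>u y v. insc_sum \<mu> u (\<lambda>l r. insc_sum \<mu> v (\<lambda>l' r'. g (l @ l') (x # r) y r')))"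
      by (rule IH) simp
    \<comment> \<open>On the other side an arc from x to y lies in the part before the marked
      letter; exchanging the two markings matches the double sums.\<close>
    finally show ?thesis
      by (simp add: Cons insc_sum_Cons split_sum_add split_sum_split_sum)
  qed simp
qed

section \<open>Coassociativity\<close>

text \<open>Multiplicativity of \<Delta> is built in: each word u of the phrase contributes either u
  \<otimes> 1 or D(u).\<close>

primrec phrase_sum ::
  "('a \<Rightarrow> 'a \<Rightarrow> 'r::comm_ring_1) \<Rightarrow> 'a phrase \<Rightarrow> ('a phrase \<Rightarrow> 'a phrase \<Rightarrow> 'b \<Rightarrow>\<^sub>0 'r) \<Rightarrow> ('b \<Rightarrow>\<^sub>0 'r)" where
  "phrase_sum \<mu> [] f = f [] []"
| "phrase_sum \<mu> (u # p) f = phrase_sum \<mu> p (\<lambda>l r. f (u # l) r) +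
     insc_sum \<mu> u (\<lambda>l' r'. phrase_sum \<mu> p (\<lambda>l r. f (l' @ l) (r' # r)))"

lemma phrase_sum_hom:
  assumes "module_hom smul smul h"
  shows "h (phrase_sum \<mu> p f) = phrase_sum \<mu> p (\<lambda>l r. h (f l r))"
  by (induction p arbitrary: f) (simp_all add: insc_sum_hom [OF assms] module_hom.add [OF assms])

lemma phrase_sum_add:
  "phrase_sum \<mu> p (\<lambda>l r. f l r + g l r) = phrase_sum \<mu> p f + phrase_sum \<mu> p g"
  by (induction p arbitrary: f g) (simp_all add: insc_sum_add)

lemma insc_sum_phrase_sum:
  "insc_sum \<mu> w (\<lambda>a b. phrase_sum \<mu> p (\<lambda>l r. f a b l r)) =
   phrase_sum \<mu> p (\<lambda>l r. insc_sum \<mu> w (\<lambda>a b. f a b l r))"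
proof (induction p arbitrary: f)
  case (Cons u p)
  show ?case
    by (simp add: insc_sum_add Cons.IH [symmetric])
      (rule insc_sum_swap)
qed simp

lemma phrase_sum_append:
  "phrase_sum \<mu> (p @ q) f =
   phrase_sum \<mu> p (\<lambda>l r. phrase_sum \<mu> q (\<lambda>l' r'. f (l @ l') (r @ r')))"
  by (induction p arbitrary: f) simp_all

lemma phrase_sum_swap:
  "phrase_sum \<mu> p (\<lambda>l r. phrase_sum \<mu> q (\<lambda>a b. f l r a b)) =
   phrase_sum \<mu> q (\<lambda>a b. phrase_sum \<mu> p (\<lambda>l r. f l r a b))"
  by (induction p arbitrary: f) (simp_all add: phrase_sum_add insc_sum_phrase_sum)

text \<open>With \<open>g\<close> in place of the triple tensor, this is (\<Delta> \<otimes> id) D =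
  (id \<otimes> D) D. If x opens an arc over u, the part u \<otimes> 1 of \<Delta>(u) corresponds to
  this arc lying in the outer inscription of the right-hand side, and D(u) to its lying in the inner
  one.\<close>

lemma insc_sum_coassoc:
  fixes g :: "'a phrase \<Rightarrow> 'a phrase \<Rightarrow> 'a word \<Rightarrow> 'b \<Rightarrow>\<^sub>0 'r::comm_ring_1"
  shows "insc_sum \<mu> w (\<lambda>l r. phrase_sum \<mu> l (\<lambda>a b. g a b r)) =
   insc_sum \<mu> w (\<lambda>l r. insc_sum \<mu> r (\<lambda>b c. g l b c))"
proof (induction w arbitrary: g rule: length_induct)
  case (1 w)
  show ?case
  proof (cases w)
    case (Cons x w')
    have IH: "insc_sum \<mu> v (\<lambda>l r. phrase_sum \<mu> l (\<lambda>a b. g a b r)) =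
        insc_sum \<mu> v (\<lambda>l r. insc_sum \<mu> r (\<lambda>b c. g l b c))"
      if "length v \<le> length w'" for v and g :: "'a phrase \<Rightarrow> 'a phrase \<Rightarrow> 'a word \<Rightarrow> 'b \<Rightarrow>\<^sub>0 'r"
      using that 1 Cons by simp
    have "insc_sum \<mu> w (\<lambda>l r. phrase_sum \<mu> l (\<lambda>a b. g a b r)) =
      insc_sum \<mu> w' (\<lambda>l r. phrase_sum \<mu> l (\<lambda>a b. g a b (x # r))) +
      split_sum w' (\<lambda>u y v. smul (\<mu> x y)
        (insc_sum \<mu> v (\<lambda>l r. phrase_sum \<mu> l (\<lambda>a b. g (u # a) b r)) +
         insc_sum \<mu> u (\<lambda>l' r'. insc_sum \<mu> v (\<lambda>l r. phrase_sum \<mu> l (\<lambda>a b. g (l' @ a) (r' # b) r)))))"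
      unfolding Cons insc_sum_Cons phrase_sum.simps insc_sum_add
      \<comment> \<open>The sum over inscriptions in u moves outside, so that the induction
        hypothesis can be applied to v.\<close>
      by (intro arg_cong2 [where f = plus] refl split_sum_cong arg_cong [where f = "smul _"] insc_sum_swap)
    also have "split_sum w' (\<lambda>u y v. smul (\<mu> x y)
        (insc_sum \<mu> v (\<lambda>l r. phrase_sum \<mu> l (\<lambda>a b. g (u # a) b r)) +
         insc_sum \<mu> u (\<lambda>l' r'. insc_sum \<mu> v (\<lambda>l r. phrase_sum \<mu> l (\<lambda>a b. g (l' @ a) (r' # b) r))))) =
      split_sum w' (\<lambda>u y v. smul (\<mu> x y)
        (insc_sum \<mu> v (\<lambda>l r. insc_sum \<mu> r (\<lambda>b c. g (u # l) b c)) +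
         insc_sum \<mu> u (\<lambda>l' r'. insc_sum \<mu> v (\<lambda>l r. insc_sum \<mu> r (\<lambda>b c. g (l' @ l) (r' # b) c)))))"
      by (rule split_sum_cong) (simp add: IH)
    also have "insc_sum \<mu> w' (\<lambda>l r. phrase_sum \<mu> l (\<lambda>a b. g a b (x # r))) =
        insc_sum \<mu> w' (\<lambda>l r. insc_sum \<mu> r (\<lambda>b c. g l b (x # c)))"
      by (rule IH) simp
    finally show ?thesis
      \<comment> \<open>An inner arc from x ends at a letter of the outer right word;
        \<open>insc_sum_split_right\<close> traces that letter back to w'.\<close>
      by (simp add: Cons insc_sum_Cons insc_sum_add insc_sum_split_right split_sum_add
          free_mod.scale_right_distrib insc_sum_smul)
  qed simp
qed

text \<open>A first word u contributes u \<otimes> 1 \<otimes> 1, D(u) \<otimes> 1, and (\<Delta>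
  \<otimes> id) D(u) against (id \<otimes> D) D(u). Fact \<open>1\<close> settles the last kind,
  fact \<open>2\<close> the middle one.\<close>

lemma phrase_sum_coassoc:
  "phrase_sum \<mu> p (\<lambda>l r. phrase_sum \<mu> l (\<lambda>a b. f a b r)) =
   phrase_sum \<mu> p (\<lambda>l r. phrase_sum \<mu> r (\<lambda>b c. f l b c))"
proof (induction p arbitrary: f)
  case (Cons u p)
  have 1: "insc_sum \<mu> u (\<lambda>l' r'. phrase_sum \<mu> p (\<lambda>l r. phrase_sum \<mu> (l' @ l) (\<lambda>a b. f a b (r' # r)))) =
    insc_sum \<mu> u (\<lambda>l' r'. phrase_sum \<mu> p (\<lambda>l r. insc_sum \<mu> r' (\<lambda>b' c'. phrase_sum \<mu> r
      (\<lambda>b c. f (l' @ l) (b' @ b) (c' # c)))))" (is "?lhs = ?rhs")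
  proof -
    have "?lhs = insc_sum \<mu> u (\<lambda>l' r'. phrase_sum \<mu> l' (\<lambda>a' b'. phrase_sum \<mu> p (\<lambda>l r. phrase_sum \<mu> l
           (\<lambda>a b. f (a' @ a) (b' @ b) (r' # r)))))"
      \<comment> \<open>The words of p are independent of u, so their sum moves inside and
        \<open>insc_sum_coassoc\<close> applies to u alone.\<close>
      unfolding phrase_sum_append phrase_sum_swap [of \<mu> p] by (rule refl)
    also have "\<dots> = insc_sum \<mu> u (\<lambda>l' r'. insc_sum \<mu> r' (\<lambda>b' c'. phrase_sum \<mu> p (\<lambda>l r. phrase_sum \<mu> l
           (\<lambda>a b. f (l' @ a) (b' @ b) (c' # r)))))"
      by (rule insc_sum_coassoc)
    also have "\<dots> = ?rhs"
      by (simp add: Cons.IH insc_sum_phrase_sum)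
    finally show ?thesis .
  qed
  have 2: "phrase_sum \<mu> p (\<lambda>l r. insc_sum \<mu> u (\<lambda>l' r'. phrase_sum \<mu> l (\<lambda>a b. f (l' @ a) (r' # b) r))) =
    insc_sum \<mu> u (\<lambda>l' r'. phrase_sum \<mu> p (\<lambda>l r. phrase_sum \<mu> r (\<lambda>b c. f (l' @ l) (r' # b) c)))"
    by (simp add: Cons.IH flip: insc_sum_phrase_sum)
  show ?case
    by (simp add: phrase_sum_add insc_sum_add Cons.IH 1 2)
qed simp

section \<open>Linear maps of free modules\<close>

lemma module_hom_smulI:
  assumes "\<And>x y. h (x + y) = h x + h y" and "\<And>c x. h (smul c x) = smul c (h x)"
  shows "module_hom smul smul h"
  using assms by (simp add: module_hom_iff free_mod.module_axioms)

lemma module_hom_lin_ext: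
  fixes f :: "'b \<Rightarrow> 'c \<Rightarrow>\<^sub>0 'r::comm_ring_1"
  shows "module_hom smul smul (lin_ext f)"
proof (rule module_hom_smulI)
  fix x y :: "'b \<Rightarrow>\<^sub>0 'r"
  let ?S = "Poly_Mapping.keys x \<union> Poly_Mapping.keys y"
  have "Poly_Mapping.keys (x + y) \<subseteq> ?S"
    by (rule keys_add)
  then show "lin_ext f (x + y) = lin_ext f x + lin_ext f y"
    by (simp add: lin_ext_superset [of ?S] lookup_add free_mod.scale_left_distrib sum.distrib)
next
  fix c :: 'r and x :: "'b \<Rightarrow>\<^sub>0 'r"
  have "Poly_Mapping.keys (smul c x) \<subseteq> Poly_Mapping.keys x"
    by (auto simp: in_keys_iff)
  then show "lin_ext f (smul c x) = smul c (lin_ext f x)"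
    by (simp add: lin_ext_superset [of "Poly_Mapping.keys x"] free_mod.scale_sum_right)
qed

lemma hom_lin_ext:
  assumes "module_hom smul smul h"
  shows "h (lin_ext g p) = lin_ext (\<lambda>b. h (g b)) p"
proof -
  interpret module_hom smul smul h by fact
  show ?thesis by (simp add: lin_ext_def sum scale)
qed

lemma hom_eq_lin_ext: "module_hom smul smul h \<Longrightarrow> h p = lin_ext (\<lambda>b. h (basis b)) p"
  using hom_lin_ext [of h basis p] basis_expansion [of p] by (simp add: lin_ext_def [of basis])

lemma lin_ext_cong:
  "(\<And>b. b \<in> Poly_Mapping.keys p \<Longrightarrow> f b = g b) \<Longrightarrow> lin_ext f p = lin_ext g p"
  by (simp add: lin_ext_def)

lemma lin_ext_closed:
  assumes "free_mod.subspace V" and "p \<in> free_on B" and "\<And>b. b \<in> B \<Longrightarrow> f b \<in> V"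
  shows "lin_ext f p \<in> V"
  using assms unfolding lin_ext_def free_on_def
  by (auto intro!: free_mod.subspace_sum free_mod.subspace_scale)

lemma subspace_free_on: "free_mod.subspace (free_on B)"
  by (auto simp: free_mod.subspace_def add_in_free_on smul_in_free_on)

lemma module_hom_tens_left: "module_hom smul smul (\<lambda>p. p \<otimes>\<^sub>R q)"
  and module_hom_tens_right: "module_hom smul smul (\<lambda>q. p \<otimes>\<^sub>R q)"
  by (simp_all add: module_hom_smulI tens_add_left tens_add_right tens_smul_left tens_smul_right)

lemma smul_mult_left: "smul c p * q = smul c (p * q)"
  for p :: "'b::monoid_add \<Rightarrow>\<^sub>0 'r::comm_ring_1"
  by (simp add: smul_def mult_map_scale_conv_mult mult.assoc)

lemma module_hom_mult_left: "module_hom smul smul (\<lambda>p. p * q)"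
  for q :: "'b::monoid_add \<Rightarrow>\<^sub>0 'r::comm_ring_1"
  by (rule module_hom_smulI) (simp_all add: smul_mult_left distrib_right)

text \<open>The monoid algebra need not be commutative, but a scalar acts as
  \<open>Poly_Mapping.single 0 c\<close>, which commutes with every basis element.\<close>

lemma smul_mult_right: "p * smul c q = smul c (p * q)"
  for p :: "'b::monoid_add \<Rightarrow>\<^sub>0 'r::comm_ring_1"
proof -
  have "basis b * (Poly_Mapping.single 0 c * q) = Poly_Mapping.single 0 c * (basis b * q)"
    for b :: 'b
    by (simp add: mult_single flip: mult.assoc)
  then have "lin_ext (\<lambda>b. basis b * smul c q) p = lin_ext (\<lambda>b. smul c (basis b * q)) p"
    by (simp add: smul_def mult_map_scale_conv_mult)
  also have "\<dots> = smul c (lin_ext (\<lambda>b. basis b * q) p)"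
    by (rule hom_lin_ext [OF free_mod.module_hom_scale_self, symmetric])
  finally show ?thesis
    by (simp only: hom_eq_lin_ext [OF module_hom_mult_left, symmetric])
qed

lemma module_hom_mult_right: "module_hom smul smul (\<lambda>q. p * q)"
  for p :: "'b::monoid_add \<Rightarrow>\<^sub>0 'r::comm_ring_1"
  by (rule module_hom_smulI) (simp_all add: smul_mult_right distrib_left)

lemma lin_ext_mult:
  fixes g :: "'b::monoid_add \<Rightarrow> 'c::monoid_add \<Rightarrow>\<^sub>0 'r::comm_ring_1"
  assumes "\<And>a b. g (a + b) = g a * g b"
  shows "lin_ext g (x * y) = lin_ext g x * lin_ext g y"
proof -
  have "x * y = lin_ext (\<lambda>a. basis a * y) x"
    by (rule hom_eq_lin_ext [OF module_hom_mult_left])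
  moreover have "basis a * y = lin_ext (\<lambda>b. basis a * basis b) y" for a
    by (rule hom_eq_lin_ext [OF module_hom_mult_right])
  ultimately have "lin_ext g (x * y) = lin_ext (\<lambda>a. lin_ext (\<lambda>b. g (a + b)) y) x"
    by (simp add: hom_lin_ext [OF module_hom_lin_ext] mult_single)
  also have "\<dots> = lin_ext (\<lambda>a. g a * lin_ext g y) x"
    by (simp add: assms hom_lin_ext [OF module_hom_mult_right])
  also have "\<dots> = lin_ext g x * lin_ext g y"
    by (simp add: hom_lin_ext [OF module_hom_mult_left])
  finally show ?thesis .
qed

text \<open>\<open>tensor_map\<close> evaluates its factors at basis elements only. Hence a
  coproduct, determined only over A, may be replaced by \<open>coprod\<close>.\<close>

lemma tensor_map_cong:
  assumes "y \<in> free_on (B \<times> C)"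
    and "\<And>b. b \<in> B \<Longrightarrow> f (basis b) = f' (basis b)" and "\<And>c. c \<in> C \<Longrightarrow> g (basis c) = g' (basis c)"
  shows "tensor_map f g y = tensor_map f' g' y"
  unfolding tensor_map_def using assms by (intro lin_ext_cong) (auto simp: free_on_def)

lemma tensor_map_basis [simp]: "tensor_map f g (basis (b, c)) = f (basis b) \<otimes>\<^sub>R g (basis c)"
  by (simp add: tensor_map_def)

lemma module_hom_tensor_map: "module_hom smul smul (tensor_map f g)"
  by (simp add: tensor_map_def module_hom_lin_ext)

lemma tensor_assoc_basis [simp]: "tensor_assoc (basis ((b, c), d)) = basis (b, c, d)"
  by (simp add: tensor_assoc_def)

lemma module_hom_tensor_assoc: "module_hom smul smul tensor_assoc"
  by (simp add: tensor_assoc_def module_hom_lin_ext)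

text \<open>The left and right words use only letters of w. This serves both for the range of
  \<Delta> and for left-handedness.\<close>

lemma insc_sum_closed:
  assumes V: "free_mod.subspace V" and "w \<in> lists A"
    and "\<And>l r. l \<in> phrases A \<Longrightarrow> r \<in> lists A \<Longrightarrow> f l r \<in> V"
  shows "insc_sum \<mu> w f \<in> V"
  using assms(2,3)
proof (induction w arbitrary: f rule: length_induct)
  case (1 w)
  show ?case
  proof (cases w)
    case Nil
    then show ?thesis using "1.prems" by (simp add: phrases_def)
  next
    case (Cons x w')
    have "insc_sum \<mu> w' (\<lambda>l r. f l (x # r)) \<in> V"
      using "1.IH" "1.prems" Cons by simp
    moreover have *: "insc_sum \<mu> v (\<lambda>l r. f (u # l) r) \<in> V" if "w' = u @ y # v" for u y v
      using "1.IH" "1.prems" Cons that by (simp add: phrases_def)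
    have "split_sum w' (\<lambda>u y v. smul (\<mu> x y) (insc_sum \<mu> v (\<lambda>l r. f (u # l) r))) \<in> V"
      unfolding split_sum_def
      by (intro free_mod.subspace_sum [OF V] free_mod.subspace_scale [OF V] *)
        (auto intro: id_take_nth_drop)
    ultimately show ?thesis
      by (simp add: Cons insc_sum_Cons free_mod.subspace_add [OF V])
  qed
qed

lemma phrase_sum_closed:
  assumes V: "free_mod.subspace V" and "p \<in> phrases A"
    and "\<And>l r. l \<in> phrases A \<Longrightarrow> r \<in> phrases A \<Longrightarrow> f l r \<in> V"
  shows "phrase_sum \<mu> p f \<in> V"
  using assms(2,3)
proof (induction p arbitrary: f)
  case (Cons u p)
  then have p: "u \<in> lists A" "p \<in> phrases A"
    by (auto simp: phrases_def)
  show ?case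
    unfolding phrase_sum.simps
    by (intro free_mod.subspace_add [OF V] insc_sum_closed [OF V p(1)] Cons.IH [OF p(2)] Cons.prems(2))
      (use p in \<open>auto simp: phrases_def\<close>)
qed simp

section \<open>The comultiplication\<close>

text \<open>Taken on phrases over the whole type, so that one map serves every alphabet A.\<close>

definition coprod ::
  "('a \<Rightarrow> 'a \<Rightarrow> 'r) \<Rightarrow> ('a phrase \<Rightarrow>\<^sub>0 'r) \<Rightarrow> ('a phrase \<times> 'a phrase \<Rightarrow>\<^sub>0 'r::comm_ring_1)" where
  "coprod \<mu> = lin_ext (\<lambda>p. phrase_sum \<mu> p (\<lambda>l r. basis (l, r)))"

lemma coprod_basis: "coprod \<mu> (basis p) = phrase_sum \<mu> p (\<lambda>l r. basis (l, r))"
  by (simp add: coprod_def)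

lemma coprod_in: "x \<in> phrase_algebra A \<Longrightarrow> coprod \<mu> x \<in> free_on (phrases A \<times> phrases A)"
  unfolding coprod_def phrase_algebra_def
  by (elim lin_ext_closed [OF subspace_free_on] phrase_sum_closed [OF subspace_free_on])
    (simp add: basis_in_free_on)

lemma coprod_mult:
  fixes \<mu> :: "'a \<Rightarrow> 'a \<Rightarrow> 'b::comm_ring_1"
  shows "coprod \<mu> (x * y) = coprod \<mu> x * coprod \<mu> y"
  unfolding coprod_def
proof (rule lin_ext_mult)
  fix p q :: "'a phrase"
  let ?D = "\<lambda>p. phrase_sum \<mu> p (\<lambda>l r. basis (l, r)) :: 'a phrase \<times> 'a phrase \<Rightarrow>\<^sub>0 'b"
  have "?D p * ?D q = phrase_sum \<mu> p (\<lambda>l r. basis (l, r) * ?D q)"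
    by (rule phrase_sum_hom [OF module_hom_mult_left])
  also have "\<dots> = phrase_sum \<mu> p (\<lambda>l r. phrase_sum \<mu> q (\<lambda>l' r'. basis (l, r) * basis (l', r')))"
    by (simp only: phrase_sum_hom [OF module_hom_mult_right])
  finally show "?D (p + q) = ?D p * ?D q"
    by (simp add: mult_single plus_list_def phrase_sum_append)
qed

lemma coprod_one: "coprod \<mu> 1 = 1"
proof -
  have "coprod \<mu> 1 = basis ([], [])"
    unfolding phrase_one coprod_basis by simp
  then show ?thesis
    by (metis single_one zero_list_def zero_prod_def)
qed

lemma coprod_word:
  "coprod \<mu> (basis [w]) = basis ([w], []) + insc_sum \<mu> w (\<lambda>l r. basis (l, [r]))"
  by (simp add: coprod_basis)

lemma hom_coprod:
  assumes "module_hom smul smul h"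
  shows "h (coprod \<mu> x) = lin_ext (\<lambda>p. phrase_sum \<mu> p (\<lambda>l r. h (basis (l, r)))) x"
  by (simp add: coprod_def hom_lin_ext [OF assms] phrase_sum_hom [OF assms])

text \<open>On a basis phrase this is \<open>phrase_sum_coassoc\<close> for
  \<open>f a b c = basis (a, b, c)\<close>.\<close>

lemma coprod_coassoc:
  "tensor_assoc (tensor_map (coprod \<mu>) id (coprod \<mu> x)) = tensor_map id (coprod \<mu>) (coprod \<mu> x)"
  by (simp add: hom_coprod [OF module_hom_tensor_map] hom_lin_ext [OF module_hom_tensor_assoc]
      coprod_basis phrase_sum_hom [OF module_hom_tens_left] phrase_sum_hom [OF module_hom_tens_right]
      phrase_sum_hom [OF module_hom_tensor_assoc] tens_basis phrase_sum_coassoc)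

section \<open>Existence and uniqueness of the comultiplication\<close>

lemma phrase_coproduct_coprod: "phrase_coproduct A \<mu> (coprod \<mu>)"
proof -
  interpret module_hom smul smul "coprod \<mu>"
    unfolding coprod_def by (rule module_hom_lin_ext)
  have "coprod \<mu> (basis [w]) = basis [w] \<otimes>\<^sub>R 1 + (\<Sum>\<alpha>\<in>inscriptions w.
      smul (insc_weight \<mu> w \<alpha>) (basis (insc_left w \<alpha>) \<otimes>\<^sub>R basis [insc_right w \<alpha>]))" for w
    by (simp add: coprod_word phrase_one tens_basis insc_sum_def)
  then show ?thesis
    by (auto simp: phrase_coproduct_def algebra_hom_on_def linear_on_def add scale coprod_in
        coprod_one coprod_mult)
qed

text \<open>One-word phrases generate the algebra, so their images and multiplicativity fix \<Delta>
  on every basis phrase.\<close>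

lemma phrase_coproduct_unique:
  assumes "phrase_coproduct A \<mu> \<Delta>" and "x \<in> phrase_algebra A"
  shows "\<Delta> x = coprod \<mu> x"
proof -
  have word: "\<Delta> (basis [w]) = coprod \<mu> (basis [w])" if "w \<in> lists A" for w
    using assms(1) phrase_coproduct_coprod [of A \<mu>] that unfolding phrase_coproduct_def by auto
  have hom: "algebra_hom_on (phrase_algebra A) (free_on (phrases A \<times> phrases A)) \<Delta>"
    using assms(1) by (simp add: phrase_coproduct_def)
  have phrase: "\<Delta> (basis p) = coprod \<mu> (basis p)" if "p \<in> phrases A" for p
    using that
  proof (induction p)
    case Nil
    have "\<Delta> 1 = coprod \<mu> 1"
      using hom by (simp add: algebra_hom_on_def coprod_one)
    then show ?case
      by (simp only: phrase_one)
  next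
    case (Cons w p)
    then have p: "w \<in> lists A" "p \<in> phrases A" "[w] \<in> phrases A"
      by (auto simp: phrases_def)
    then have "\<Delta> (basis [w] * basis p) = \<Delta> (basis [w]) * \<Delta> (basis p)"
      using hom by (simp add: algebra_hom_on_def phrase_algebra_def basis_in_free_on)
    then show ?case
      using Cons.IH p word by (simp add: phrase_mult flip: coprod_mult)
  qed
  have x: "x \<in> free_on (phrases A)" using assms(2) by (simp add: phrase_algebra_def)
  have "\<Delta> x = (\<Sum>p\<in>Poly_Mapping.keys x. smul (Poly_Mapping.lookup x p) (\<Delta> (basis p)))"
    using hom by (intro linear_sum_on_free_on [OF free_mod.module_axioms _ _ x])
      (auto simp: algebra_hom_on_def linear_on_def phrase_algebra_def)
  also have "\<dots> = (\<Sum>p\<in>Poly_Mapping.keys x. smul (Poly_Mapping.lookup x p) (coprod \<mu> (basis p)))"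
    using x phrase by (intro sum.cong) (auto simp: free_on_def)
  also have "\<dots> = coprod \<mu> x"
    by (simp add: coprod_def lin_ext_def [of _ x])
  finally show ?thesis .
qed

lemma free_on_mult:
  fixes x y :: "'b::monoid_add \<Rightarrow>\<^sub>0 'r::comm_ring_1"
  assumes "x \<in> free_on B" and "y \<in> free_on C" and "\<And>b c. b \<in> B \<Longrightarrow> c \<in> C \<Longrightarrow> b + c \<in> D"
  shows "x * y \<in> free_on D"
  using keys_mult [of x y] assms by (force simp: free_on_def)

lemma submonoid_phrases: "submonoid (phrases A)"
  by (simp add: submonoid_def phrases_def zero_list_def plus_list_def)

lemma phrase_algebra_mult:
  "x \<in> phrase_algebra A \<Longrightarrow> y \<in> phrase_algebra A \<Longrightarrow> x * y \<in> phrase_algebra A"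
  using submonoid_phrases unfolding phrase_algebra_def submonoid_def by (blast intro: free_on_mult)

text \<open>\<Delta> is a total function constrained only on the phrase algebra, so uniqueness is
  stated among functions with the default value elsewhere.\<close>

lemma phrase_coproduct_exists_unique:
  fixes \<mu> :: "'a \<Rightarrow> 'a \<Rightarrow> 'r::comm_ring_1"
  shows "\<exists>!\<Delta>. \<Delta> \<in> extensional (phrase_algebra A) \<and> phrase_coproduct A \<mu> \<Delta>"
proof (rule ex1I [of _ "restrict (coprod \<mu>) (phrase_algebra A)"])
  let ?Q = "phrase_algebra A :: ('a phrase \<Rightarrow>\<^sub>0 'r) set"
  \<comment> \<open>By these closure properties the restriction agrees with \<open>coprod\<close>
    wherever the conditions evaluate it.\<close>
  have "1 \<in> ?Q"
    by (auto simp: phrase_algebra_def phrase_one phrases_def intro!: basis_in_free_on)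
  moreover have "x + y \<in> ?Q" if "x \<in> ?Q" "y \<in> ?Q" for x y
    using that by (simp add: phrase_algebra_def add_in_free_on)
  moreover have "smul c x \<in> ?Q" if "x \<in> ?Q" for c x
    using that by (simp add: phrase_algebra_def smul_in_free_on)
  moreover have "basis [w] \<in> ?Q" if "w \<in> lists A" for w
    using that by (simp add: phrase_algebra_def phrases_def basis_in_free_on)
  moreover have "restrict (coprod \<mu>) ?Q \<in> ?Q \<rightarrow> free_on (phrases A \<times> phrases A)"
    by (simp add: coprod_in)
  ultimately show "restrict (coprod \<mu>) ?Q \<in> extensional ?Q \<and>
      phrase_coproduct A \<mu> (restrict (coprod \<mu>) ?Q)"
    using phrase_coproduct_coprod [of A \<mu>]
    by (simp add: phrase_coproduct_def algebra_hom_on_def linear_on_def phrase_algebra_mult)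
next
  fix \<Delta> assume "\<Delta> \<in> extensional (phrase_algebra A) \<and> phrase_coproduct A \<mu> \<Delta>"
  then show "\<Delta> = restrict (coprod \<mu>) (phrase_algebra A)"
    by (auto simp: phrase_coproduct_unique intro!: extensionalityI [OF _ restrict_extensional])
qed

section \<open>Grading and leading term\<close>

definition length_part :: "nat \<Rightarrow> ('a phrase \<Rightarrow>\<^sub>0 'r) \<Rightarrow> ('a phrase \<Rightarrow>\<^sub>0 'r::comm_ring_1)" where
  "length_part m = lin_ext (\<lambda>p. if length p = m then basis p else 0)"

lemma lookup_length_part [simp]:
  "Poly_Mapping.lookup (length_part m x) p = (if length p = m then Poly_Mapping.lookup x p else 0)"
proof -
  have "Poly_Mapping.lookup (length_part m x) p =
      (\<Sum>q\<in>Poly_Mapping.keys x. if q = p then (if length p = m then Poly_Mapping.lookup x p else 0) else 0)"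
    unfolding length_part_def lin_ext_def lookup_sum
    by (rule sum.cong) (auto simp: lookup_single)
  then show ?thesis
    by (simp add: in_keys_iff)
qed

text \<open>The coefficient at p can only come from degree \<open>length p\<close>. The equivalence
  gives existence and uniqueness of the decomposition and evaluates the \<open>THE\<close> in
  \<open>component\<close>.\<close>

lemma decomposes_iff_length_part:
  fixes x :: "'a phrase \<Rightarrow>\<^sub>0 'r::comm_ring_1"
  assumes x: "x \<in> free_on (phrases A)"
  shows "decomposes (phrase_grading A) x f \<longleftrightarrow> f = (\<lambda>m. length_part m x)"
proof
  assume f: "decomposes (phrase_grading A) x f"
  then have fin: "finite {m. f m \<noteq> 0}" and sum: "x = (\<Sum>m | f m \<noteq> 0. f m)"
    by (simp_all add: decomposes_def)
  have other: "Poly_Mapping.lookup (f m) p = 0" if "length p \<noteq> m" for m p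
  proof -
    have "Poly_Mapping.keys (f m) \<subseteq> {p. length p = m}"
      using f by (auto simp: decomposes_def phrase_grading_def free_on_def)
    then show ?thesis
      using that by (auto simp: in_keys_iff)
  qed
  have "Poly_Mapping.lookup x p = Poly_Mapping.lookup (f (length p)) p" for p
  proof -
    have "Poly_Mapping.lookup x p = (\<Sum>m | f m \<noteq> 0. Poly_Mapping.lookup (f m) p)"
      by (subst sum) (rule lookup_sum)
    also have "\<dots> = (\<Sum>m | f m \<noteq> 0. if m = length p then Poly_Mapping.lookup (f m) p else 0)"
      by (rule sum.cong) (auto simp: other)
    also have "\<dots> = Poly_Mapping.lookup (f (length p)) p"
      using fin by simp
    finally show ?thesis .
  qed
  then show "f = (\<lambda>m. length_part m x)"
    using other by (auto simp: fun_eq_iff intro!: poly_mapping_eqI)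
next
  assume f: "f = (\<lambda>m. length_part m x)"
  have keys: "{m. f m \<noteq> 0} \<subseteq> length ` Poly_Mapping.keys x"
  proof
    fix m assume "m \<in> {m. f m \<noteq> 0}"
    then obtain p where "Poly_Mapping.lookup (length_part m x) p \<noteq> 0"
      using f by (auto simp: poly_mapping_eq_iff fun_eq_iff)
    then show "m \<in> length ` Poly_Mapping.keys x"
      by (auto simp: in_keys_iff split: if_splits)
  qed
  then have fin: "finite {m. f m \<noteq> 0}"
    by (rule finite_subset) simp
  have "Poly_Mapping.lookup x p = (\<Sum>m | f m \<noteq> 0. Poly_Mapping.lookup (f m) p)" for p
  proof -
    have "(\<Sum>m | f m \<noteq> 0. Poly_Mapping.lookup (f m) p) =
        (\<Sum>m | f m \<noteq> 0. if m = length p then Poly_Mapping.lookup x p else 0)"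
      by (rule sum.cong) (auto simp: f)
    also have "\<dots> = Poly_Mapping.lookup x p"
    proof (cases "f (length p) = 0")
      case True
      \<comment> \<open>A zero component is missing from the index set, but then the coefficient of
        x at p is zero as well.\<close>
      then have "Poly_Mapping.lookup (length_part (length p) x) p = 0"
        by (simp only: f lookup_zero)
      with True fin show ?thesis by simp
    qed (use fin in simp)
    finally show ?thesis by simp
  qed
  then have "x = (\<Sum>m | f m \<noteq> 0. f m)"
    by (intro poly_mapping_eqI) (simp add: lookup_sum)
  moreover have "f m \<in> phrase_grading A m" for m
    using x by (auto simp: f phrase_grading_def free_on_def in_keys_iff subset_eq split: if_splits)
  ultimately show "decomposes (phrase_grading A) x f"
    using fin by (simp add: decomposes_def)
qed

lemma component_phrase_grading:
  "x \<in> free_on (phrases A) \<Longrightarrow> component (phrase_grading A) m x = length_part m x"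
  by (simp add: component_def decomposes_iff_length_part)

lemma phrase_grading_le: "phrase_grading A m \<subseteq> free_on (phrases A)"
  by (auto simp: phrase_grading_def free_on_def)

lemma algebra_grading_phrases:
  "algebra_grading (phrases A) (phrase_grading A :: nat \<Rightarrow> ('a phrase \<Rightarrow>\<^sub>0 'r::comm_ring_1) set)"
  unfolding algebra_grading_def
proof (intro conjI allI ballI)
  show "free_mod.subspace (phrase_grading A m)" for m
    by (simp add: phrase_grading_def subspace_free_on)
  show "phrase_grading A m \<subseteq> free_on (phrases A)" for m
    by (rule phrase_grading_le)
  show "\<exists>!f. decomposes (phrase_grading A) p f" if "p \<in> free_on (phrases A)"
    for p :: "'a phrase \<Rightarrow>\<^sub>0 'r"
    by (simp add: decomposes_iff_length_part [OF that])
  show "1 \<in> phrase_grading A 0"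
    by (auto simp: phrase_grading_def phrase_one phrases_def intro!: basis_in_free_on)
  show "x * y \<in> phrase_grading A (m + n)" if "x \<in> phrase_grading A m" "y \<in> phrase_grading A n"
    for m n and x y :: "'a phrase \<Rightarrow>\<^sub>0 'r"
    using that unfolding phrase_grading_def
    by (rule free_on_mult) (auto simp: plus_list_def phrases_def)
qed

lemma bialgebra_phrases:
  assumes "phrase_coproduct A \<mu> \<Delta>"
  shows "bialgebra (phrases A) \<Delta>"
proof -
  have eq: "\<Delta> x = coprod \<mu> x" if "x \<in> free_on (phrases A)" for x
    using phrase_coproduct_unique [OF assms] that by (simp add: phrase_algebra_def)
  have "tensor_assoc (tensor_map \<Delta> id (\<Delta> x)) = tensor_map id \<Delta> (\<Delta> x)"
    if x: "x \<in> free_on (phrases A)" for x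
  proof -
    have y: "coprod \<mu> x \<in> free_on (phrases A \<times> phrases A)"
      using x by (simp add: coprod_in phrase_algebra_def)
    have "tensor_map \<Delta> id (coprod \<mu> x) = tensor_map (coprod \<mu>) id (coprod \<mu> x)"
      and "tensor_map id \<Delta> (coprod \<mu> x) = tensor_map id (coprod \<mu>) (coprod \<mu> x)"
      by (rule tensor_map_cong [OF y]; simp add: eq basis_in_free_on)+
    then show ?thesis
      by (simp add: eq [OF x] coprod_coassoc)
  qed
  then show ?thesis
    using assms submonoid_phrases [of A]
    by (simp add: bialgebra_def phrase_coproduct_def algebra_hom_on_def phrase_algebra_def tens_one)
qed

text \<open>Only the empty inscription has an empty left phrase: in the recursion every arc puts a
  word in front.\<close>

lemma insc_sum_Nil_part:
  "insc_sum \<mu> w (\<lambda>l r. if l = [] then f l r else 0) = f [] w"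
  by (induction w arbitrary: f) (simp_all add: insc_sum_Cons split_sum_def)

text \<open>The empty inscription yields 1 \<otimes> w. Every other term of D(w) has a nonempty left
  phrase, which has positive degree, and a single word on the right.\<close>

lemma left_handed_phrases:
  assumes "phrase_coproduct A \<mu> \<Delta>" and a: "a \<in> phrase_grading A 1"
  shows "\<Delta> a - a \<otimes>\<^sub>R 1 - 1 \<otimes>\<^sub>R a \<in> tensor_sub (positive_part (phrase_grading A)) (phrase_grading A 1)"
    (is "_ \<in> ?V")
proof -
  let ?h = "\<lambda>a. coprod \<mu> a - a \<otimes>\<^sub>R 1 - 1 \<otimes>\<^sub>R a"
  have "a \<in> phrase_algebra A"
    using a phrase_grading_le by (auto simp: phrase_algebra_def)
  then have "\<Delta> a - a \<otimes>\<^sub>R 1 - 1 \<otimes>\<^sub>R a = ?h a"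
    by (simp add: phrase_coproduct_unique [OF assms(1)])
  \<comment> \<open>The expression is linear in a, so one-word phrases suffice.\<close>
  also have "\<dots> = lin_ext (\<lambda>p. ?h (basis p)) a"
    unfolding coprod_def
    by (intro hom_eq_lin_ext module_pair.module_hom_sub module_pair.intro free_mod.module_axioms
        module_hom_lin_ext module_hom_tens_left module_hom_tens_right)
  also have "\<dots> \<in> ?V"
  proof (rule lin_ext_closed)
    show V: "free_mod.subspace ?V"
      by (simp add: tensor_sub_def)
    show "a \<in> free_on {p \<in> phrases A. length p = 1}"
      using a by (simp add: phrase_grading_def)
    fix p assume "p \<in> {p \<in> phrases A. length p = 1}"
    then obtain w where p: "p = [w]" "w \<in> lists A"
      by (auto simp: phrases_def length_Suc_conv)
    have "insc_sum \<mu> w (\<lambda>l r. basis (l, [r])) =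
        insc_sum \<mu> w (\<lambda>l r. (if l = [] then basis (l, [r]) else 0) + (if l = [] then 0 else basis (l, [r])))"
      by (rule arg_cong [where f = "insc_sum \<mu> w"]) (simp add: fun_eq_iff)
    also have "\<dots> = basis ([], [w]) + insc_sum \<mu> w (\<lambda>l r. if l = [] then 0 else basis (l, [r]))"
      unfolding insc_sum_add by (simp add: insc_sum_Nil_part [where f = "\<lambda>l r. basis (l, [r])"])
    finally have "?h (basis p) = insc_sum \<mu> w (\<lambda>l r. if l = [] then 0 else basis (l, [r]))"
      by (simp add: p coprod_word phrase_one tens_basis)
    also have "\<dots> \<in> ?V"
    proof (rule insc_sum_closed [OF V p(2)])
      fix l r assume lr: "l \<in> phrases A" "r \<in> lists A"
      have "basis l \<otimes>\<^sub>R basis [r] \<in> ?V" if "l \<noteq> []"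
      proof -
        have "basis l \<in> positive_part (phrase_grading A)"
          using that lr unfolding positive_part_def
          by (intro free_mod.span_base UN_I [of "length l"])
            (auto simp: phrase_grading_def Suc_le_eq intro!: basis_in_free_on)
        moreover have "basis [r] \<in> phrase_grading A 1"
          using lr by (auto simp: phrase_grading_def phrases_def intro!: basis_in_free_on)
        ultimately show ?thesis
          unfolding tensor_sub_def by (intro free_mod.span_base) blast
      qed
      then show "(if l = [] then 0 else basis (l, [r])) \<in> ?V"
        using free_mod.subspace_0 [OF V] by (simp flip: tens_basis)
    qed
    finally show "?h (basis p) \<in> ?V" .
  qed
  finally show ?thesis .
qed

text \<open>Induction from the end of w. If the first letter of the suffix opens an arc, the rest is
  the empty inscription, by \<open>insc_sum_Nil_part\<close>; otherwise that letter joins the right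
  word.\<close>

lemma insc_sum_one_arc_drop:
  assumes "k \<le> length w"
  shows "insc_sum \<mu> (drop k w) (\<lambda>l r. if length l = 1 then f (hd l) r else 0) =
    (\<Sum>i\<in>{Suc k..length w}. \<Sum>j\<in>{Suc i..length w}. smul (\<mu> (letter w i) (letter w j))
       (f (subword w (Suc i) j) (subword w (Suc k) i @ drop j w)))"
  using assms
proof (induction k arbitrary: f rule: inc_induct)
  case base
  then show ?case by simp
next
  case (step k)
  then have "drop k w = letter w (Suc k) # drop (Suc k) w"
    by (simp add: letter_def Cons_nth_drop_Suc)
  then have "insc_sum \<mu> (drop k w) (\<lambda>l r. if length l = 1 then f (hd l) r else 0) =
     insc_sum \<mu> (drop (Suc k) w) (\<lambda>l r. if length l = 1 then f (hd l) (letter w (Suc k) # r) else 0) +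
     split_sum (drop (Suc k) w) (\<lambda>u y v. smul (\<mu> (letter w (Suc k)) y)
       (insc_sum \<mu> v (\<lambda>l r. if l = [] then f u r else 0)))"
    by (simp add: insc_sum_Cons cong: if_cong)
  \<comment> \<open>The empty word \<open>subword w (Suc k) (Suc k)\<close> is written out so that
    this sum becomes the summand i = \<open>Suc k\<close>.\<close>
  also have "split_sum (drop (Suc k) w) (\<lambda>u y v. smul (\<mu> (letter w (Suc k)) y)
       (insc_sum \<mu> v (\<lambda>l r. if l = [] then f u r else 0))) =
     (\<Sum>j\<in>{Suc (Suc k)..length w}. smul (\<mu> (letter w (Suc k)) (letter w j))
       (f (subword w (Suc (Suc k)) j) (subword w (Suc k) (Suc k) @ drop j w)))"
    by (simp add: split_sum_drop insc_sum_Nil_part [where f = "\<lambda>l. f _"])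
  also have "insc_sum \<mu> (drop (Suc k) w) (\<lambda>l r. if length l = 1 then f (hd l) (letter w (Suc k) # r) else 0) =
    (\<Sum>i\<in>{Suc (Suc k)..length w}. \<Sum>j\<in>{Suc i..length w}. smul (\<mu> (letter w i) (letter w j))
       (f (subword w (Suc i) j) (subword w (Suc k) i @ drop j w)))"
    unfolding step.IH [of "\<lambda>u r. f u (letter w (Suc k) # r)"]
    by (simp add: subword_Cons [of "Suc k"])
  finally show ?case
    using step by (simp add: sum.atLeast_Suc_atMost [of "Suc k"] add.commute)
qed

lemma insc_sum_one_arc:
  "insc_sum \<mu> w (\<lambda>l r. if length l = 1 then f (hd l) r else 0) =
    (\<Sum>(i, j)\<in>{(i, j). 1 \<le> i \<and> i < j \<and> j \<le> length w}. smul (\<mu> (letter w i) (letter w j))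
       (f (subword w (i + 1) j) (subword w 1 i @ subword w (j + 1) (length w + 1))))"
proof -
  have "{(i, j). 1 \<le> i \<and> i < j \<and> j \<le> length w} =
      Sigma {Suc 0..length w} (\<lambda>i. {Suc i..length w})"
    by auto
  then show ?thesis
    using insc_sum_one_arc_drop [of 0 w \<mu> f]
    by (simp add: sum.Sigma subword_take_drop cong: sum.cong)
qed

lemma tens_zero: "p \<otimes>\<^sub>R 0 = 0" "0 \<otimes>\<^sub>R q = 0"
  by (simp_all add: tens_def lin_ext_def)

text \<open>Projecting both factors to length 1 removes w \<otimes> 1 and leaves the inscriptions
  with exactly one arc, which give the terms of \<open>rho\<close>.\<close>

lemma leading_term_phrases:
  assumes \<Delta>: "phrase_coproduct A \<mu> \<Delta>" and x: "x \<in> word_module A"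
  shows "leading_term (phrase_grading A) \<Delta> (one_word x) = tensor_map one_word one_word (rho \<mu> x)"
proof -
  let ?\<pi> = "component (phrase_grading A) 1"
  have one_word: "one_word x \<in> phrase_grading A 1"
    unfolding one_word_def phrase_grading_def
    using x by (auto simp: word_module_def phrases_def
        intro!: lin_ext_closed [OF subspace_free_on] basis_in_free_on)
  then have alg: "one_word x \<in> phrase_algebra A"
    using phrase_grading_le by (auto simp: phrase_algebra_def)
  have "leading_term (phrase_grading A) \<Delta> (one_word x) = tensor_map ?\<pi> ?\<pi> (coprod \<mu> (one_word x))"
    using one_word by (simp add: leading_term_def phrase_coproduct_unique [OF \<Delta> alg])
  also have "\<dots> = tensor_map (length_part 1) (length_part 1) (coprod \<mu> (one_word x))"
    by (rule tensor_map_cong [OF coprod_in [OF alg]])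
      (simp_all add: component_phrase_grading basis_in_free_on)
  also have "\<dots> = lin_ext (\<lambda>w. tensor_map (length_part 1) (length_part 1) (coprod \<mu> (basis [w]))) x"
    by (simp only: one_word_def coprod_def hom_lin_ext [OF module_hom_lin_ext]
        hom_lin_ext [OF module_hom_tensor_map] lin_ext_basis)
  also have "\<dots> = lin_ext (\<lambda>w. tensor_map one_word one_word (rho \<mu> (basis w))) x"
  proof (rule lin_ext_cong)
    fix w :: "'a word"
    have part: "length_part 1 (basis p) = (if length p = 1 then basis p else 0 :: 'a phrase \<Rightarrow>\<^sub>0 'b)" for p
      by (simp add: length_part_def)
    have "tensor_map (length_part 1) (length_part 1) (coprod \<mu> (basis [w])) =
      tensor_map (length_part 1) (length_part 1) (basis ([w], [])) +
      insc_sum \<mu> w (\<lambda>l r. tensor_map (length_part 1) (length_part 1) (basis (l, [r])))"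
      by (simp only: coprod_word module_hom.add [OF module_hom_tensor_map] insc_sum_hom [OF module_hom_tensor_map])
    \<comment> \<open>The right factor \<open>[]\<close> of the first term has length 0, while
      \<open>[r]\<close> always has length 1, so in the sum only the length of l is tested.\<close>
    also have "\<dots> = insc_sum \<mu> w (\<lambda>l r. if length l = 1 then basis ([hd l], [r]) else 0)"
      unfolding tensor_map_basis part
      by (auto simp: tens_basis tens_zero length_Suc_conv fun_eq_iff intro!: arg_cong [where f = "insc_sum \<mu> w"])
    also have "\<dots> = tensor_map one_word one_word (rho \<mu> (basis w))"
      unfolding insc_sum_one_arc [where f = "\<lambda>u r. basis ([u], [r])"]
      by (simp add: rho_def module_hom.sum [OF module_hom_tensor_map] case_prod_unfold
          module_hom.scale [OF module_hom_tensor_map] tens_basis one_word_def)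
    finally show "tensor_map (length_part 1) (length_part 1) (coprod \<mu> (basis [w])) =
      tensor_map one_word one_word (rho \<mu> (basis w))" .
  qed
  also have "\<dots> = tensor_map one_word one_word (rho \<mu> x)"
    by (simp add: rho_def hom_lin_ext [OF module_hom_tensor_map])
  finally show ?thesis .
qed

theorem theorem6p1p1:
  fixes A :: "'a set" and \<mu> :: "'a \<Rightarrow> 'a \<Rightarrow> 'r::comm_ring_1"
  shows "(\<exists>!\<Delta>. \<Delta> \<in> extensional (phrase_algebra A) \<and> phrase_coproduct A \<mu> \<Delta>) \<and>
    (\<forall>\<Delta>. phrase_coproduct A \<mu> \<Delta> \<longrightarrow>
       left_handed_graded_bialgebra (phrases A) (phrase_grading A) \<Delta> \<and>
       (\<forall>x\<in>word_module A.
          leading_term (phrase_grading A) \<Delta> (one_word x) =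
            tensor_map one_word one_word (rho \<mu> x)))"
proof (intro conjI allI impI ballI)
  show "\<exists>!\<Delta>. \<Delta> \<in> extensional (phrase_algebra A) \<and> phrase_coproduct A \<mu> \<Delta>"
    by (rule phrase_coproduct_exists_unique)
next
  fix \<Delta> assume \<Delta>: "phrase_coproduct A \<mu> \<Delta>"
  then show "left_handed_graded_bialgebra (phrases A) (phrase_grading A) \<Delta>"
    by (simp add: left_handed_graded_bialgebra_def graded_bialgebra_def bialgebra_phrases
        algebra_grading_phrases left_handed_phrases del: One_nat_def)
  fix x :: "'a word \<Rightarrow>\<^sub>0 'r" assume "x \<in> word_module A"
  with \<Delta> show "leading_term (phrase_grading A) \<Delta> (one_word x) = tensor_map one_word one_word (rho \<mu> x)"
    by (rule leading_term_phrases)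
qed

end
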